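(* Let $L>0$ and let $\mathcal{D}$ be a real distribution on the interval $[0,L]$. Let $Q$ be the hermitian form defined on trigonometric polynomials on $[0,L]$ by $$\langle f\mid g\rangle_Q:=\mathcal{D}\big(x\mapsto (f^**g)(x)+(f^**g)(-x)\big),\qquad x\in[0,L].$$ Assume that $Q$ defines a lower-bounded essentially selfadjoint operator, with selfadjoint closure $A$ on $L^2([0,L],dx)$, and that the minimum of the spectrum of $A$ is a simple, isolated eigenvalue $\lambda$ with even eigenfunction $\xi\neq 0$ (i.e. $\xi(L-x)=\xi(x)$ for almost every $x\in[0,L]$). Then all the zeros of the entire function $$\widehat\xi(z)=\int_0^L \xi(x)\,e^{-izx}\,dx,\qquad z\in\mathbb{C},$$ lie on the real line.
   Context: A distribution $\mathcal{D}$ on $[0,L]$ is a continuous linear form on $C^\infty([0,L])$ (functions smooth up to the boundary, with the usual Fréchet topology); it is real if it takes real values on real-valued functions. Trigonometric polynomials on $[0,L]$ are the finite linear combinations of the orthonormal basis $U_n(x)=L^{-1/2}\exp(2\pi i n x/L)$, $n\in\mathbb{Z}$, of $L^2([0,L],dx)$; they are extended to $\mathbb{R}$ by $0$ outside $[0,L]$. For functions on $\mathbb{R}$, $f^*(x):=\overline{f(-x)}$ and $(f*g)(y):=\int f(x)g(y-x)\,dx$; for trigonometric polynomials $f,g$ (extended by $0$) the function $x\mapsto (f^**g)(x)+(f^**g)(-x)$ is smooth on $[0,L]$. That $Q$ defines a lower-bounded essentially selfadjoint operator means: there is an operator with domain the trigonometric polynomials satisfying $\langle \alpha\mid A\beta\rangle=\langle\alpha\mid\beta\rangle_Q$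 for all trigonometric polynomials $\alpha,\beta$, which is bounded below and essentially selfadjoint; its closure is denoted $A$ (so the trigonometric polynomials form a core for $A$). Inner products are antilinear in the first variable. *)

theory Defs
  imports "HOL-Analysis.Analysis"
begin

text \<open>
  A function on \<open>[0,L]\<close> is represented by its extension by \<open>0\<close> to the real line, so that equality
  in \<open>C\<^sup>\<infinity>([0,L])\<close> is equality of functions \<open>real \<Rightarrow> complex\<close>.
\<close>

definition zero_ext :: "real \<Rightarrow> (real \<Rightarrow> complex) \<Rightarrow> real \<Rightarrow> complex" where
  "zero_ext L f = (\<lambda>x. if x \<in> {0..L} then f x else 0)"

text \<open>Derivatives at the endpoints \<open>0\<close> and \<open>L\<close> are one-sided.\<close>

definition interval_deriv :: "real \<Rightarrow> (real \<Rightarrow> complex) \<Rightarrow> real \<Rightarrow> complex" where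
  "interval_deriv L f = zero_ext L (\<lambda>x. vector_derivative f (at x within {0..L}))"

definition smooth_functions :: "real \<Rightarrow> (real \<Rightarrow> complex) set" where
  "smooth_functions L =
     {f. (\<forall>x. x \<notin> {0..L} \<longrightarrow> f x = 0) \<and>
         (\<forall>k. (interval_deriv L ^^ k) f differentiable_on {0..L})}"

definition smooth_seminorm :: "real \<Rightarrow> nat \<Rightarrow> (real \<Rightarrow> complex) \<Rightarrow> real" where
  "smooth_seminorm L k f = (SUP x\<in>{0..L}. norm ((interval_deriv L ^^ k) f x))"

definition smooth_topology :: "real \<Rightarrow> (real \<Rightarrow> complex) topology" where
  "smooth_topology L = topology_generated_by
     {{f \<in> smooth_functions L. smooth_seminorm L k (\<lambda>x. f x - g x) < r} | k g r.
        g \<in> smooth_functions L \<and> r > 0}"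

text \<open>Only the values of \<open>D\<close> on \<^term>\<open>smooth_functions L\<close> are meaningful.\<close>

definition distribution :: "real \<Rightarrow> ((real \<Rightarrow> complex) \<Rightarrow> complex) \<Rightarrow> bool" where
  "distribution L D \<longleftrightarrow>
     (\<forall>f\<in>smooth_functions L. \<forall>g\<in>smooth_functions L. D (\<lambda>x. f x + g x) = D f + D g) \<and>
     (\<forall>c. \<forall>f\<in>smooth_functions L. D (\<lambda>x. c * f x) = c * D f) \<and>
     continuous_map (smooth_topology L) euclidean D"

definition real_distribution :: "real \<Rightarrow> ((real \<Rightarrow> complex) \<Rightarrow> complex) \<Rightarrow> bool" where
  "real_distribution L D \<longleftrightarrow>
     distribution L D \<and> (\<forall>f\<in>smooth_functions L. (\<forall>x. f x \<in> \<real>) \<longrightarrow> D f \<in> \<real>)"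

definition trig_basis :: "real \<Rightarrow> int \<Rightarrow> real \<Rightarrow> complex" where
  "trig_basis L n = zero_ext L
     (\<lambda>x. complex_of_real (1 / sqrt L) *
          exp (2 * complex_of_real pi * \<i> * of_int n * complex_of_real x / complex_of_real L))"

definition trig_polys :: "real \<Rightarrow> (real \<Rightarrow> complex) set" where
  "trig_polys L = {\<lambda>x. \<Sum>n\<in>S. c n * trig_basis L n x | S c. finite S}"

definition star :: "(real \<Rightarrow> complex) \<Rightarrow> real \<Rightarrow> complex" where
  "star f = (\<lambda>x. cnj (f (- x)))"

definition convolution :: "(real \<Rightarrow> complex) \<Rightarrow> (real \<Rightarrow> complex) \<Rightarrow> real \<Rightarrow> complex" where
  "convolution f g = (\<lambda>y. \<integral>x. f x * g (y - x) \<partial>lborel)"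

definition form_Q ::
  "real \<Rightarrow> ((real \<Rightarrow> complex) \<Rightarrow> complex) \<Rightarrow> (real \<Rightarrow> complex) \<Rightarrow> (real \<Rightarrow> complex) \<Rightarrow> complex" where
  "form_Q L D f g =
     D (zero_ext L (\<lambda>x. convolution (star f) g x + convolution (star f) g (- x)))"

text \<open>
  Elements of \<open>L\<^sup>2([0,L],dx)\<close> are represented by square-integrable functions, with \<open>l2_eq\<close> (equality
  almost everywhere on \<open>[0,L]\<close>) in the role of equality. Values outside \<open>[0,L]\<close> are irrelevant.
\<close>

definition l2_functions :: "real \<Rightarrow> (real \<Rightarrow> complex) set" where
  "l2_functions L = {f \<in> borel_measurable (lebesgue_on {0..L}).
     integrable (lebesgue_on {0..L}) (\<lambda>x. (norm (f x))\<^sup>2)}"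

definition l2_eq :: "real \<Rightarrow> (real \<Rightarrow> complex) \<Rightarrow> (real \<Rightarrow> complex) \<Rightarrow> bool" where
  "l2_eq L f g \<longleftrightarrow> (AE x in lebesgue_on {0..L}. f x = g x)"

definition l2_inner :: "real \<Rightarrow> (real \<Rightarrow> complex) \<Rightarrow> (real \<Rightarrow> complex) \<Rightarrow> complex" where
  "l2_inner L f g = (\<integral>x. cnj (f x) * g x \<partial>lebesgue_on {0..L})"

definition l2_norm :: "real \<Rightarrow> (real \<Rightarrow> complex) \<Rightarrow> real" where
  "l2_norm L f = sqrt (\<integral>x. (norm (f x))\<^sup>2 \<partial>lebesgue_on {0..L})"

text \<open>
  An unbounded operator is represented by its graph, a set of pairs of representatives that is
  invariant under changing either component on a null set.
\<close>

type_synonym l2_graph = "((real \<Rightarrow> complex) \<times> (real \<Rightarrow> complex)) set"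

definition op_domain :: "l2_graph \<Rightarrow> (real \<Rightarrow> complex) set" where
  "op_domain T = {f. \<exists>g. (f, g) \<in> T}"

definition l2_operator :: "real \<Rightarrow> l2_graph \<Rightarrow> bool" where
  "l2_operator L T \<longleftrightarrow>
     T \<subseteq> l2_functions L \<times> l2_functions L \<and>
     (\<forall>(f, g)\<in>T. \<forall>f'\<in>l2_functions L. \<forall>g'\<in>l2_functions L.
        l2_eq L f f' \<longrightarrow> l2_eq L g g' \<longrightarrow> (f', g') \<in> T) \<and>
     (\<lambda>x. 0, \<lambda>x. 0) \<in> T \<and>
     (\<forall>(f, g)\<in>T. \<forall>(u, v)\<in>T. (\<lambda>x. f x + u x, \<lambda>x. g x + v x) \<in> T) \<and>
     (\<forall>c. \<forall>(f, g)\<in>T. (\<lambda>x. c * f x, \<lambda>x. c * g x) \<in> T) \<and>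
     (\<forall>f g h. (f, g) \<in> T \<longrightarrow> (f, h) \<in> T \<longrightarrow> l2_eq L g h)"

definition densely_defined :: "real \<Rightarrow> l2_graph \<Rightarrow> bool" where
  "densely_defined L T \<longleftrightarrow>
     (\<forall>h\<in>l2_functions L. \<forall>\<epsilon>>0. \<exists>f\<in>op_domain T. l2_norm L (\<lambda>x. h x - f x) < \<epsilon>)"

definition op_adjoint :: "real \<Rightarrow> l2_graph \<Rightarrow> l2_graph" where
  "op_adjoint L T = {(f, g) \<in> l2_functions L \<times> l2_functions L.
     \<forall>(u, v)\<in>T. l2_inner L f v = l2_inner L g u}"

definition op_closure :: "real \<Rightarrow> l2_graph \<Rightarrow> l2_graph" where
  "op_closure L T = {(f, g) \<in> l2_functions L \<times> l2_functions L.
     \<forall>\<epsilon>>0. \<exists>(u, v)\<in>T. l2_norm L (\<lambda>x. f x - u x) < \<epsilon> \<and> l2_norm L (\<lambda>x. g x - v x) < \<epsilon>}"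

definition symmetric_op :: "real \<Rightarrow> l2_graph \<Rightarrow> bool" where
  "symmetric_op L T \<longleftrightarrow> (\<forall>(f, g)\<in>T. \<forall>(u, v)\<in>T. l2_inner L f v = l2_inner L g u)"

definition selfadjoint :: "real \<Rightarrow> l2_graph \<Rightarrow> bool" where
  "selfadjoint L T \<longleftrightarrow> l2_operator L T \<and> densely_defined L T \<and> op_adjoint L T = T"

definition essentially_selfadjoint :: "real \<Rightarrow> l2_graph \<Rightarrow> bool" where
  "essentially_selfadjoint L T \<longleftrightarrow>
     l2_operator L T \<and> densely_defined L T \<and> symmetric_op L T \<and> selfadjoint L (op_closure L T)"

definition lower_bounded :: "real \<Rightarrow> l2_graph \<Rightarrow> bool" where
  "lower_bounded L T \<longleftrightarrow>
     (\<exists>c::real. \<forall>(f, g)\<in>T. l2_inner L f g \<in> \<real> \<and> c * (l2_norm L f)\<^sup>2 \<le> Re (l2_inner L f g))"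

definition operator_of_form :: "real \<Rightarrow> ((real \<Rightarrow> complex) \<Rightarrow> complex) \<Rightarrow> l2_graph \<Rightarrow> bool" where
  "operator_of_form L D T \<longleftrightarrow>
     l2_operator L T \<and>
     op_domain T = {f \<in> l2_functions L. \<exists>p\<in>trig_polys L. l2_eq L f p} \<and>
     (\<forall>\<alpha>\<in>trig_polys L. \<forall>\<beta>\<in>trig_polys L. \<forall>h. (\<beta>, h) \<in> T \<longrightarrow> l2_inner L \<alpha> h = form_Q L D \<alpha> \<beta>)"

text \<open>\<open>z\<close> is in the resolvent set if \<open>T - z\<close> is injective and onto, with bounded inverse.\<close>

definition op_resolvent_set :: "real \<Rightarrow> l2_graph \<Rightarrow> complex set" where
  "op_resolvent_set L T = {z.
     (\<forall>(f, g)\<in>T. l2_eq L (\<lambda>x. g x - z * f x) (\<lambda>x. 0) \<longrightarrow> l2_eq L f (\<lambda>x. 0)) \<and>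
     (\<forall>h\<in>l2_functions L. \<exists>(f, g)\<in>T. l2_eq L (\<lambda>x. g x - z * f x) h) \<and>
     (\<exists>C. \<forall>(f, g)\<in>T. l2_norm L f \<le> C * l2_norm L (\<lambda>x. g x - z * f x))}"

definition op_spectrum :: "real \<Rightarrow> l2_graph \<Rightarrow> complex set" where
  "op_spectrum L T = - op_resolvent_set L T"

definition eigenspace :: "l2_graph \<Rightarrow> complex \<Rightarrow> (real \<Rightarrow> complex) set" where
  "eigenspace T z = {f. (f, \<lambda>x. z * f x) \<in> T}"

definition simple_eigenvalue :: "real \<Rightarrow> l2_graph \<Rightarrow> complex \<Rightarrow> bool" where
  "simple_eigenvalue L T z \<longleftrightarrow>
     (\<exists>e\<in>eigenspace T z. \<not> l2_eq L e (\<lambda>x. 0) \<and>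
        (\<forall>f\<in>eigenspace T z. \<exists>c. l2_eq L f (\<lambda>x. c * e x)))"

definition fourier_hat :: "real \<Rightarrow> (real \<Rightarrow> complex) \<Rightarrow> complex \<Rightarrow> complex" where
  "fourier_hat L \<xi> z =
     (\<integral>x. \<xi> x * exp (- \<i> * z * complex_of_real x) \<partial>lebesgue_on {0..L})"

end

theory Submission
  imports Defs
begin

text \<open>
  Let \<open>z\<close> be a nonreal zero of the Fourier transform of the ground state \<open>\<xi>\<close>. Multiplying the transform by
  \<open>(w - cnj z) / (w - z)\<close>, of modulus \<open>1\<close> for real \<open>w\<close>, gives the transform of another function
  \<open>\<eta> = \<xi> + i(z - cnj z) V \<xi>\<close> supported in \<open>[0,L]\<close>, where \<open>V\<close> is the Volterra operator that inverts
  \<open>d/dx - iz\<close>. Since \<open>Q(f,f)\<close> depends on \<open>f\<close> only through \<open>f\<^sup>* * f\<close>, which this does not change, \<open>\<eta>\<close>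
  is again a ground state. By simplicity \<open>\<eta>\<close>, hence \<open>V \<xi>\<close>, is a multiple of \<open>\<xi>\<close>. Comparing Fourier
  coefficients, only one coefficient of \<open>\<xi>\<close> can be nonzero; but \<open>z\<close> is not a zero of the transform of a
  single \<open>U\<^sub>n\<close>, so \<open>\<xi> = 0\<close>. Everything is carried out on trigonometric polynomials \<open>p \<rightarrow> \<xi>\<close>, corrected
  by a multiple of \<open>U\<^sub>0\<close> so that \<open>z\<close> is a zero of each of their transforms; then \<open>V p\<close> is again a trigonometric
  polynomial.
\<close>

subsection \<open>Square-integrable functions\<close>

text \<open>The discriminant argument behind the Cauchy-Schwarz inequality, freed from any inner
  product so that it serves both \<open>l2_inner\<close> and the semidefinite form of a selfadjoint
  operator minus a lower bound.\<close>

lemma norm_square_le_if_quadratic_nonneg: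
  fixes a b :: real and c :: complex
  assumes "a \<ge> 0" and "b \<ge> 0" and "\<And>t::complex. a + 2 * Re (t * c) + (norm t)\<^sup>2 * b \<ge> 0"
  shows "(norm c)\<^sup>2 \<le> a * b"
proof -
  \<comment> \<open>With \<open>t = - s * cnj c\<close> the product \<open>t * c\<close> is real,
    which leaves a quadratic in the real variable \<open>s\<close>.\<close>
  have q: "a - 2 * s * (norm c)\<^sup>2 + s\<^sup>2 * (norm c)\<^sup>2 * b \<ge> 0" for s :: real
  proof -
    have "complex_of_real (-s) * cnj c * c = of_real (- s * (norm c)\<^sup>2)"
      by (metis complex_norm_square mult.assoc mult.commute of_real_mult)
    hence "Re (complex_of_real (-s) * cnj c * c) = - s * (norm c)\<^sup>2"
      by (metis Re_complex_of_real)
    moreover have "(norm (complex_of_real (-s) * cnj c))\<^sup>2 = s\<^sup>2 * (norm c)\<^sup>2"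
      by (simp add: norm_mult power_mult_distrib)
    ultimately show ?thesis
      using assms(3)[of "complex_of_real (-s) * cnj c"] by (simp add: algebra_simps)
  qed
  show ?thesis
  proof (cases "b = 0")
    case True
    have "(norm c)\<^sup>2 = 0"
    proof (rule ccontr)
      assume *: "(norm c)\<^sup>2 \<noteq> 0"
      \<comment> \<open>The quadratic is now affine in \<open>s\<close>; this value of
        \<open>s\<close> gives \<open>a - 2 * (a + 1)\<close>, which is negative.\<close>
      have "(a + 1) / (norm c)\<^sup>2 * (norm c)\<^sup>2 = a + 1" using * by simp
      then show False
        using q[of "(a + 1) / (norm c)\<^sup>2"] True assms(1) by (simp only: mult.assoc) simp
    qed
    then show ?thesis using assms by simp
  next
    case False
    then have "b > 0" using assms by simp
    \<comment> \<open>The quadratic attains its minimum at \<open>s = 1 / b\<close>.\<close>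
    have "a - 2 * (1 / b) * (norm c)\<^sup>2 + (1 / b)\<^sup>2 * (norm c)\<^sup>2 * b \<ge> 0"
      by (rule q)
    also have "a - 2 * (1 / b) * (norm c)\<^sup>2 + (1 / b)\<^sup>2 * (norm c)\<^sup>2 * b = a - (norm c)\<^sup>2 / b"
      using \<open>b > 0\<close> by (simp add: field_simps power2_eq_square)
    finally show ?thesis using \<open>b > 0\<close> by (simp add: field_simps)
  qed
qed

section \<open>Integrability and linear structure\<close>

lemma l2_measurable: "f \<in> l2_functions L \<Longrightarrow> f \<in> borel_measurable (lebesgue_on {0..L})"
  by (simp add: l2_functions_def)

lemma l2_integrable_square:
  "f \<in> l2_functions L \<Longrightarrow> integrable (lebesgue_on {0..L}) (\<lambda>x. (norm (f x))\<^sup>2)"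
  by (simp add: l2_functions_def)

lemma measurable_cnj [measurable (raw)]:
  "f \<in> borel_measurable M \<Longrightarrow> (\<lambda>x. cnj (f x)) \<in> borel_measurable M"
  by (rule borel_measurable_continuous_on[where f = cnj]) (auto intro: continuous_intros)

lemma l2_integrable_norm_mult:
  assumes "f \<in> l2_functions L" "g \<in> l2_functions L"
  shows "integrable (lebesgue_on {0..L}) (\<lambda>x. norm (f x) * norm (g x))"
proof (rule Bochner_Integration.integrable_bound)
  show "integrable (lebesgue_on {0..L}) (\<lambda>x. (norm (f x))\<^sup>2 + (norm (g x))\<^sup>2)"
    using assms by (intro Bochner_Integration.integrable_add l2_integrable_square)
  show "(\<lambda>x. norm (f x) * norm (g x)) \<in> borel_measurable (lebesgue_on {0..L})"
    using assms[THEN l2_measurable] by measurable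
  have "a * b \<le> a\<^sup>2 + b\<^sup>2" if "a \<ge> 0" "b \<ge> 0" for a b :: real
    using sum_squares_bound[of a b] mult_nonneg_nonneg[OF that] by simp
  then show "AE x in lebesgue_on {0..L}. norm (norm (f x) * norm (g x))
      \<le> norm ((norm (f x))\<^sup>2 + (norm (g x))\<^sup>2)"
    by simp
qed

lemma l2_integrable_mult:
  assumes "f \<in> l2_functions L" "g \<in> l2_functions L"
  shows "integrable (lebesgue_on {0..L}) (\<lambda>x. f x * g x)"
proof (rule Bochner_Integration.integrable_bound[OF l2_integrable_norm_mult[OF assms]])
  show "(\<lambda>x. f x * g x) \<in> borel_measurable (lebesgue_on {0..L})"
    using assms[THEN l2_measurable] by measurable
qed (simp add: norm_mult)

lemma l2_cnj: "f \<in> l2_functions L \<Longrightarrow> (\<lambda>x. cnj (f x)) \<in> l2_functions L"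
  by (simp add: l2_functions_def measurable_cnj)

lemma l2_inner_integrable:
  assumes "f \<in> l2_functions L" "g \<in> l2_functions L"
  shows "integrable (lebesgue_on {0..L}) (\<lambda>x. cnj (f x) * g x)"
  using l2_integrable_mult[OF l2_cnj[OF assms(1)] assms(2)] .

lemma l2_scale: "f \<in> l2_functions L \<Longrightarrow> (\<lambda>x. c * f x) \<in> l2_functions L"
  by (auto simp: l2_functions_def norm_mult power_mult_distrib)

lemma l2_add:
  assumes "f \<in> l2_functions L" "g \<in> l2_functions L"
  shows "(\<lambda>x. f x + g x) \<in> l2_functions L"
proof -
  have m: "(\<lambda>x. f x + g x) \<in> borel_measurable (lebesgue_on {0..L})"
    using assms[THEN l2_measurable] by measurable
  have "integrable (lebesgue_on {0..L}) (\<lambda>x. (norm (f x + g x))\<^sup>2)"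
  proof (rule Bochner_Integration.integrable_bound)
    show "integrable (lebesgue_on {0..L})
        (\<lambda>x. (norm (f x))\<^sup>2 + 2 * (norm (f x) * norm (g x)) + (norm (g x))\<^sup>2)"
      using assms l2_integrable_norm_mult[OF assms]
      by (intro Bochner_Integration.integrable_add l2_integrable_square) auto
    show "(\<lambda>x. (norm (f x + g x))\<^sup>2) \<in> borel_measurable (lebesgue_on {0..L})"
      using m by measurable
    have "(norm (a + b))\<^sup>2 \<le> (norm a)\<^sup>2 + 2 * (norm a * norm b) + (norm b)\<^sup>2" for a b :: complex
      using power_mono[OF norm_triangle_ineq[of a b], of 2] by (simp add: power2_sum algebra_simps)
    then show "AE x in lebesgue_on {0..L}. norm ((norm (f x + g x))\<^sup>2)
       \<le> norm ((norm (f x))\<^sup>2 + 2 * (norm (f x) * norm (g x)) + (norm (g x))\<^sup>2)"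
      by simp
  qed
  with m show ?thesis by (simp add: l2_functions_def)
qed

lemma l2_diff:
  assumes "f \<in> l2_functions L" "g \<in> l2_functions L"
  shows "(\<lambda>x. f x - g x) \<in> l2_functions L"
  using l2_add[OF assms(1) l2_scale[OF assms(2), of "-1"]] by simp

lemma l2_continuous:
  assumes "continuous_on {0..L} f"
  shows "f \<in> l2_functions L"
proof -
  have "f \<in> borel_measurable (lebesgue_on {0..L})"
    by (rule continuous_imp_measurable_on_sets_lebesgue[OF assms]) auto
  moreover have "integrable (lebesgue_on {0..L}) (\<lambda>x. (norm (f x))\<^sup>2)"
    by (intro continuous_imp_integrable_real continuous_intros assms)
  ultimately show ?thesis by (simp add: l2_functions_def)
qed

section \<open>Inner product and norm\<close>

lemma l2_inner_add_right:
  assumes "f \<in> l2_functions L" "g \<in> l2_functions L" "h \<in> l2_functions L"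
  shows "l2_inner L f (\<lambda>x. g x + h x) = l2_inner L f g + l2_inner L f h"
  using assms by (simp add: l2_inner_def ring_distribs l2_inner_integrable)

lemma l2_inner_diff_right:
  assumes "f \<in> l2_functions L" "g \<in> l2_functions L" "h \<in> l2_functions L"
  shows "l2_inner L f (\<lambda>x. g x - h x) = l2_inner L f g - l2_inner L f h"
  using assms by (simp add: l2_inner_def ring_distribs l2_inner_integrable)

lemma l2_inner_scale_right: "l2_inner L f (\<lambda>x. c * g x) = c * l2_inner L f g"
proof -
  have "(\<lambda>x. cnj (f x) * (c * g x)) = (\<lambda>x. c * (cnj (f x) * g x))" by (simp add: ac_simps)
  then show ?thesis by (simp add: l2_inner_def)
qed

lemma l2_inner_commute: "l2_inner L g f = cnj (l2_inner L f g)"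
proof -
  have "cnj (l2_inner L f g) = (\<integral>x. cnj (cnj (f x) * g x) \<partial>lebesgue_on {0..L})"
    by (simp only: l2_inner_def Bochner_Integration.integral_cnj)
  then show ?thesis by (simp add: l2_inner_def mult.commute)
qed

lemma l2_inner_add_left:
  assumes "f \<in> l2_functions L" "g \<in> l2_functions L" "h \<in> l2_functions L"
  shows "l2_inner L (\<lambda>x. g x + h x) f = l2_inner L g f + l2_inner L h f"
  using assms by (simp add: l2_inner_def ring_distribs l2_inner_integrable)

lemma l2_inner_diff_left:
  assumes "f \<in> l2_functions L" "g \<in> l2_functions L" "h \<in> l2_functions L"
  shows "l2_inner L (\<lambda>x. g x - h x) f = l2_inner L g f - l2_inner L h f"
  using assms by (simp add: l2_inner_def ring_distribs l2_inner_integrable)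

lemma l2_inner_scale_left: "l2_inner L (\<lambda>x. c * f x) g = cnj c * l2_inner L f g"
  by (simp add: l2_inner_def mult.assoc)

lemma l2_norm_nonneg: "l2_norm L f \<ge> 0"
  by (simp add: l2_norm_def)

lemma l2_norm_square: "(l2_norm L f)\<^sup>2 = (\<integral>x. (norm (f x))\<^sup>2 \<partial>lebesgue_on {0..L})"
  by (simp add: l2_norm_def)

lemma l2_inner_self: "l2_inner L f f = of_real ((l2_norm L f)\<^sup>2)"
proof -
  have "(\<lambda>x. cnj (f x) * f x) = (\<lambda>x. complex_of_real ((norm (f x))\<^sup>2))"
    by (simp add: fun_eq_iff complex_norm_square mult.commute del: of_real_power)
  then have "l2_inner L f f = (\<integral>x. complex_of_real ((norm (f x))\<^sup>2) \<partial>lebesgue_on {0..L})"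
    by (simp only: l2_inner_def)
  then show ?thesis by (simp only: integral_complex_of_real l2_norm_square)
qed

lemma l2_norm_add_scale_square:
  assumes "f \<in> l2_functions L" "g \<in> l2_functions L"
  shows "(l2_norm L (\<lambda>x. f x + t * g x))\<^sup>2 =
    (l2_norm L f)\<^sup>2 + 2 * Re (t * l2_inner L f g) + (norm t)\<^sup>2 * (l2_norm L g)\<^sup>2"
proof -
  let ?h = "\<lambda>x. f x + t * g x"
  have tg: "(\<lambda>x. t * g x) \<in> l2_functions L" using assms by (intro l2_scale)
  then have h: "?h \<in> l2_functions L" using assms by (intro l2_add)
  have "l2_inner L ?h ?h = l2_inner L f f + t * l2_inner L f g + cnj (t * l2_inner L f g)
      + (t * cnj t) * l2_inner L g g"
    using assms tg h
    by (simp add: l2_inner_add_left l2_inner_add_right l2_inner_scale_left l2_inner_scale_right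
        l2_inner_commute[of L g f] algebra_simps)
  then have "Re (l2_inner L ?h ?h) = Re (l2_inner L f f + t * l2_inner L f g
      + cnj (t * l2_inner L f g) + of_real ((norm t)\<^sup>2) * l2_inner L g g)"
    by (metis complex_norm_square)
  then show ?thesis by (simp add: l2_inner_self del: of_real_power)
qed

lemma l2_cauchy_schwarz:
  assumes "f \<in> l2_functions L" "g \<in> l2_functions L"
  shows "norm (l2_inner L f g) \<le> l2_norm L f * l2_norm L g"
proof -
  have "(norm (l2_inner L f g))\<^sup>2 \<le> (l2_norm L f)\<^sup>2 * (l2_norm L g)\<^sup>2"
  proof (rule norm_square_le_if_quadratic_nonneg)
    fix t
    show "0 \<le> (l2_norm L f)\<^sup>2 + 2 * Re (t * l2_inner L f g) + (norm t)\<^sup>2 * (l2_norm L g)\<^sup>2"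
      by (metis l2_norm_add_scale_square[OF assms] zero_le_power2)
  qed simp_all
  then have "(norm (l2_inner L f g))\<^sup>2 \<le> (l2_norm L f * l2_norm L g)\<^sup>2"
    by (simp add: power_mult_distrib)
  then show ?thesis
    by (rule power2_le_imp_le) (simp add: l2_norm_nonneg)
qed

lemma l2_norm_scale: "l2_norm L (\<lambda>x. c * f x) = norm c * l2_norm L f"
  by (simp add: l2_norm_def norm_mult power_mult_distrib real_sqrt_mult)

lemma l2_norm_triangle:
  assumes "f \<in> l2_functions L" "g \<in> l2_functions L"
  shows "l2_norm L (\<lambda>x. f x + g x) \<le> l2_norm L f + l2_norm L g"
proof (rule power2_le_imp_le)
  have "Re (l2_inner L f g) \<le> l2_norm L f * l2_norm L g"
    using complex_Re_le_cmod l2_cauchy_schwarz[OF assms] by (rule order_trans)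
  then show "(l2_norm L (\<lambda>x. f x + g x))\<^sup>2 \<le> (l2_norm L f + l2_norm L g)\<^sup>2"
    using l2_norm_add_scale_square[OF assms, of 1] by (simp add: power2_sum)
qed (simp add: l2_norm_nonneg)

lemma l2_norm_minus_commute: "l2_norm L (\<lambda>x. f x - g x) = l2_norm L (\<lambda>x. g x - f x)"
  by (simp add: l2_norm_def norm_minus_commute)

lemma l2_norm_eq_0_iff:
  assumes "f \<in> l2_functions L"
  shows "l2_norm L f = 0 \<longleftrightarrow> l2_eq L f (\<lambda>x. 0)"
  using integral_nonneg_eq_0_iff_AE[OF l2_integrable_square[OF assms]]
  by (simp add: l2_norm_def l2_eq_def)

lemma l2_norm_cong:
  assumes "f \<in> l2_functions L" "g \<in> l2_functions L" "l2_eq L f g"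
  shows "l2_norm L f = l2_norm L g"
proof -
  have "(\<integral>x. (norm (f x))\<^sup>2 \<partial>lebesgue_on {0..L}) = (\<integral>x. (norm (g x))\<^sup>2 \<partial>lebesgue_on {0..L})"
    by (rule integral_cong_AE) (use assms in \<open>auto simp: l2_functions_def l2_eq_def\<close>)
  then show ?thesis by (simp add: l2_norm_def)
qed

lemma l2_inner_cong_right:
  assumes "f \<in> l2_functions L" "g \<in> l2_functions L" "h \<in> l2_functions L" "l2_eq L g h"
  shows "l2_inner L f g = l2_inner L f h"
  unfolding l2_inner_def
  by (rule integral_cong_AE)
    (use assms in \<open>auto simp: l2_eq_def intro!: borel_measurable_integrable l2_inner_integrable\<close>)

text \<open>Cauchy-Schwarz applied to the absolute values. With the norm inside the integral, the
  estimate also controls integrals over subintervals, as the bound on the Volterra operator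
  requires.\<close>

lemma l2_integral_norm_mult_le:
  assumes "f \<in> l2_functions L" "g \<in> l2_functions L"
  shows "(\<integral>x. norm (f x) * norm (g x) \<partial>lebesgue_on {0..L}) \<le> l2_norm L f * l2_norm L g"
proof -
  have abs: "(\<lambda>x. complex_of_real (norm (f x))) \<in> l2_functions L" if "f \<in> l2_functions L" for f
    using that by (auto simp: l2_functions_def)
  have "l2_inner L (\<lambda>x. complex_of_real (norm (f x))) (\<lambda>x. complex_of_real (norm (g x)))
     = of_real (\<integral>x. norm (f x) * norm (g x) \<partial>lebesgue_on {0..L})"
    by (simp add: l2_inner_def flip: of_real_mult)
  moreover have "norm (l2_inner L (\<lambda>x. complex_of_real (norm (f x))) (\<lambda>x. complex_of_real (norm (g x))))
     \<le> l2_norm L (\<lambda>x. complex_of_real (norm (f x))) * l2_norm L (\<lambda>x. complex_of_real (norm (g x)))"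
    by (rule l2_cauchy_schwarz[OF assms[THEN abs]])
  ultimately show ?thesis by (simp add: l2_norm_def)
qed

subsection \<open>Lower bounds of selfadjoint operators\<close>

lemma l2_operatorD:
  assumes "l2_operator L T"
  shows "T \<subseteq> l2_functions L \<times> l2_functions L"
    and "\<And>f g f' g'. (f, g) \<in> T \<Longrightarrow> f' \<in> l2_functions L \<Longrightarrow> g' \<in> l2_functions L \<Longrightarrow>
      l2_eq L f f' \<Longrightarrow> l2_eq L g g' \<Longrightarrow> (f', g') \<in> T"
    and "\<And>f g u v. (f, g) \<in> T \<Longrightarrow> (u, v) \<in> T \<Longrightarrow> (\<lambda>x. f x + u x, \<lambda>x. g x + v x) \<in> T"
    and "\<And>c f g. (f, g) \<in> T \<Longrightarrow> (\<lambda>x. c * f x, \<lambda>x. c * g x) \<in> T"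
  using assms unfolding l2_operator_def by blast+

lemma selfadjoint_symmetric:
  assumes "selfadjoint L A" "(f, g) \<in> A" "(u, v) \<in> A"
  shows "l2_inner L f v = l2_inner L g u"
  using assms unfolding selfadjoint_def op_adjoint_def by blast

text \<open>The constant is a parameter here, so that the supremum of all lower bounds can be formed
  and compared with the spectrum.\<close>

definition lower_bound :: "real \<Rightarrow> l2_graph \<Rightarrow> real \<Rightarrow> bool" where
  "lower_bound L A c \<longleftrightarrow> (\<forall>(f, g)\<in>A. c * (l2_norm L f)\<^sup>2 \<le> Re (l2_inner L f g))"

text \<open>The form of \<open>A - c\<close> is positive semidefinite on the domain of
  \<open>A\<close>, hence obeys Cauchy-Schwarz; the quadratic is its value at
  \<open>f + t g\<close>. A vector on which this form is small is therefore almost orthogonal to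
  each \<open>(A - c) g\<close>.\<close>

lemma lower_bound_cauchy_schwarz:
  assumes A: "selfadjoint L A" and c: "lower_bound L A c" and f: "(f, f') \<in> A" and g: "(g, g') \<in> A"
  shows "(norm (l2_inner L f g' - of_real c * l2_inner L f g))\<^sup>2 \<le>
    (Re (l2_inner L f f') - c * (l2_norm L f)\<^sup>2) * (Re (l2_inner L g g') - c * (l2_norm L g)\<^sup>2)"
proof (rule norm_square_le_if_quadratic_nonneg)
  show "0 \<le> Re (l2_inner L f f') - c * (l2_norm L f)\<^sup>2"
    and "0 \<le> Re (l2_inner L g g') - c * (l2_norm L g)\<^sup>2"
    using c f g unfolding lower_bound_def by auto
next
  fix t
  have op: "l2_operator L A" using A by (simp add: selfadjoint_def)
  note l2 = l2_operatorD(1)[OF op]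
  have L: "f \<in> l2_functions L" "g \<in> l2_functions L" "f' \<in> l2_functions L" "g' \<in> l2_functions L"
    using l2 f g by auto
  have "(\<lambda>x. f x + t * g x, \<lambda>x. f' x + t * g' x) \<in> A"
    by (intro l2_operatorD(3,4)[OF op] f g)
  then have "c * (l2_norm L (\<lambda>x. f x + t * g x))\<^sup>2
     \<le> Re (l2_inner L (\<lambda>x. f x + t * g x) (\<lambda>x. f' x + t * g' x))"
    using c unfolding lower_bound_def by blast
  \<comment> \<open>Symmetry of \<open>A\<close> makes the two cross terms conjugate to each
    other.\<close>
  moreover have "l2_inner L (\<lambda>x. f x + t * g x) (\<lambda>x. f' x + t * g' x)
     = l2_inner L f f' + t * l2_inner L f g' + cnj (t * l2_inner L f g')
       + (t * cnj t) * l2_inner L g g'"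
    using selfadjoint_symmetric[OF A f g] l2_inner_commute[of L g f'] L
    by (simp add: l2_inner_add_left l2_inner_add_right l2_inner_scale_left l2_inner_scale_right
        l2_scale l2_add algebra_simps)
  moreover have "t * cnj t = of_real ((norm t)\<^sup>2)"
    by (simp only: complex_norm_square)
  ultimately have "c * ((l2_norm L f)\<^sup>2 + 2 * Re (t * l2_inner L f g) + (norm t)\<^sup>2 * (l2_norm L g)\<^sup>2)
     \<le> Re (l2_inner L f f') + 2 * Re (t * l2_inner L f g') + (norm t)\<^sup>2 * Re (l2_inner L g g')"
    unfolding l2_norm_add_scale_square[OF L(1,2)] by (simp del: of_real_power)
  moreover have "Re (t * (l2_inner L f g' - of_real c * l2_inner L f g))
      = Re (t * l2_inner L f g') - c * Re (t * l2_inner L f g)"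
    by (simp add: algebra_simps)
  ultimately show "0 \<le> Re (l2_inner L f f') - c * (l2_norm L f)\<^sup>2
      + 2 * Re (t * (l2_inner L f g' - of_real c * l2_inner L f g))
      + (norm t)\<^sup>2 * (Re (l2_inner L g g') - c * (l2_norm L g)\<^sup>2)"
    by (simp only: distrib_left right_diff_distrib left_diff_distrib mult.assoc mult.left_commute)
qed

text \<open>
  With \<open>R = (A - m)\<^sup>-\<^sup>1\<close> bounded by \<open>C\<close>, apply Cauchy-Schwarz for the form of \<open>A - m\<close> to \<open>f\<close> and \<open>R f\<close>.
\<close>

lemma lower_bound_improve:
  assumes A: "selfadjoint L A" and m: "lower_bound L A m"
    and res: "of_real m \<in> op_resolvent_set L A"
  shows "\<exists>d>0. lower_bound L A (m + d)"
proof -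
  note l2 = l2_operatorD(1)[OF A[unfolded selfadjoint_def, THEN conjunct1]]
  from res have onto: "\<forall>h\<in>l2_functions L. \<exists>(f, g)\<in>A. l2_eq L (\<lambda>x. g x - of_real m * f x) h"
    and "\<exists>C. \<forall>(f, g)\<in>A. l2_norm L f \<le> C * l2_norm L (\<lambda>x. g x - of_real m * f x)"
    unfolding op_resolvent_set_def by auto
  then obtain C where C0: "\<forall>(f, g)\<in>A. l2_norm L f \<le> C * l2_norm L (\<lambda>x. g x - of_real m * f x)"
    by blast
  have C: "l2_norm L f \<le> max C 1 * l2_norm L (\<lambda>x. g x - of_real m * f x)" if "(f, g) \<in> A" for f g
  proof -
    have "l2_norm L f \<le> C * l2_norm L (\<lambda>x. g x - of_real m * f x)" using C0 that by blast
    also have "\<dots> \<le> max C 1 * l2_norm L (\<lambda>x. g x - of_real m * f x)"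
      by (intro mult_right_mono l2_norm_nonneg) simp
    finally show ?thesis .
  qed
  \<comment> \<open>The maximum makes the resolvent bound positive; the lower bound will rise by
    \<open>1 / K\<close>.\<close>
  define K where "K = max C 1"
  have "K > 0" by (simp add: K_def)
  have "(m + 1 / K) * (l2_norm L f)\<^sup>2 \<le> Re (l2_inner L f f')" if f: "(f, f') \<in> A" for f f'
  proof -
    have fL: "f \<in> l2_functions L" using f l2 by blast
    obtain g g' where g: "(g, g') \<in> A" and eq: "l2_eq L (\<lambda>x. g' x - of_real m * g x) f"
      using onto fL by blast
    have gL: "g \<in> l2_functions L" "g' \<in> l2_functions L" using g l2 by blast+
    let ?r = "\<lambda>x. g' x - of_real m * g x"
    have rL: "?r \<in> l2_functions L" using gL by (intro l2_diff l2_scale)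
    have nr: "l2_norm L ?r = l2_norm L f" by (rule l2_norm_cong[OF rL fL eq])
    \<comment> \<open>Here \<open>g\<close> is \<open>R f\<close>: pairing with
      \<open>(A - m) g\<close> is pairing with \<open>f\<close>. For \<open>h = f\<close> this
      yields the squared norm of \<open>f\<close>, for \<open>h = g\<close> the form of
      \<open>A - m\<close> at \<open>g\<close>.\<close>
    have ip: "l2_inner L h g' - of_real m * l2_inner L h g = l2_inner L h f" if "h \<in> l2_functions L" for h
      using l2_inner_cong_right[OF that rL fL eq] that gL
      by (simp add: l2_inner_diff_right l2_inner_scale_right l2_scale)
    have "(norm (l2_inner L f f))\<^sup>2 \<le>
       (Re (l2_inner L f f') - m * (l2_norm L f)\<^sup>2) * (Re (l2_inner L g g') - m * (l2_norm L g)\<^sup>2)"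
      using lower_bound_cauchy_schwarz[OF A m f g] ip[OF fL] by simp
    also have "Re (l2_inner L g g') - m * (l2_norm L g)\<^sup>2 = Re (l2_inner L g f)"
      unfolding ip[OF gL(1), symmetric] by (simp add: l2_inner_self del: of_real_power)
    finally have *: "((l2_norm L f)\<^sup>2)\<^sup>2 \<le>
       (Re (l2_inner L f f') - m * (l2_norm L f)\<^sup>2) * Re (l2_inner L g f)"
      by (simp add: l2_inner_self norm_power)
    have "Re (l2_inner L g f) \<le> l2_norm L g * l2_norm L f"
      using complex_Re_le_cmod l2_cauchy_schwarz[OF gL(1) fL] by (rule order_trans)
    also have "\<dots> \<le> (K * l2_norm L f) * l2_norm L f"
      using C[OF g] nr by (intro mult_right_mono l2_norm_nonneg) (simp add: K_def)
    finally have "Re (l2_inner L g f) \<le> K * (l2_norm L f)\<^sup>2" by (simp add: power2_eq_square)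
    moreover have "0 \<le> Re (l2_inner L f f') - m * (l2_norm L f)\<^sup>2"
      using m f unfolding lower_bound_def by auto
    ultimately have "((l2_norm L f)\<^sup>2)\<^sup>2 \<le>
       (Re (l2_inner L f f') - m * (l2_norm L f)\<^sup>2) * (K * (l2_norm L f)\<^sup>2)"
      using * by (meson mult_left_mono order_trans)
    then have **: "(l2_norm L f)\<^sup>2 * (l2_norm L f)\<^sup>2 \<le>
       (K * (Re (l2_inner L f f') - m * (l2_norm L f)\<^sup>2)) * (l2_norm L f)\<^sup>2"
      by (simp add: power2_eq_square ac_simps)
    have "(l2_norm L f)\<^sup>2 \<le> K * (Re (l2_inner L f f') - m * (l2_norm L f)\<^sup>2)"
    proof (cases "l2_norm L f = 0")
      case True
      then show ?thesis
        using \<open>K > 0\<close> \<open>0 \<le> Re (l2_inner L f f') - m * (l2_norm L f)\<^sup>2\<close> by simp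
    next
      case False
      then show ?thesis using ** by (metis mult_right_le_imp_le zero_less_power2)
    qed
    then show ?thesis using \<open>K > 0\<close> by (simp add: field_simps)
  qed
  then have "lower_bound L A (m + 1 / K)" unfolding lower_bound_def by blast
  then show ?thesis using \<open>K > 0\<close> by (meson zero_less_divide_1_iff)
qed

text \<open>The largest lower bound belongs to the spectrum: at a point of the resolvent set
  \<open>lower_bound_improve\<close> would produce a larger one. So \<open>lam\<close> is at most
  this supremum, and is itself a lower bound.\<close>

lemma lower_bound_of_spectrum:
  assumes A: "selfadjoint L A" and c: "lower_bound L A c"
    and f: "(f, f') \<in> A" "l2_norm L f \<noteq> 0"
    and spec: "\<And>\<mu>::real. of_real \<mu> \<in> op_spectrum L A \<Longrightarrow> lam \<le> \<mu>"
  shows "lower_bound L A lam"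
proof -
  define B where "B = {c. lower_bound L A c}"
  \<comment> \<open>No lower bound exceeds the Rayleigh quotient of \<open>f\<close>; this makes the
    supremum finite.\<close>
  have bdd: "b \<le> Re (l2_inner L f f') / (l2_norm L f)\<^sup>2" if "b \<in> B" for b
    using that f unfolding B_def lower_bound_def by (auto simp: field_simps)
  then have "bdd_above B" by (meson bdd_above.I)
  have "B \<noteq> {}" using c by (auto simp: B_def)
  \<comment> \<open>The supremum is attained: for each fixed vector, being a lower bound is a closed
    condition on the constant.\<close>
  have "Sup B * (l2_norm L u)\<^sup>2 \<le> Re (l2_inner L u v)" if uv: "(u, v) \<in> A" for u v
  proof -
    have ub: "b * (l2_norm L u)\<^sup>2 \<le> Re (l2_inner L u v)" if "b \<in> B" for b
      using that uv unfolding B_def lower_bound_def by blast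
    show ?thesis
    proof (cases "l2_norm L u = 0")
      case True
      then show ?thesis using ub \<open>B \<noteq> {}\<close> by auto
    next
      case False
      then have "Sup B \<le> Re (l2_inner L u v) / (l2_norm L u)\<^sup>2"
        using ub by (intro cSup_least[OF \<open>B \<noteq> {}\<close>]) (simp add: field_simps)
      then show ?thesis using False by (simp add: field_simps)
    qed
  qed
  then have S: "lower_bound L A (Sup B)" unfolding lower_bound_def by blast
  have "of_real (Sup B) \<notin> op_resolvent_set L A"
  proof
    assume "of_real (Sup B) \<in> op_resolvent_set L A"
    then obtain d where "d > 0" "Sup B + d \<in> B"
      using lower_bound_improve[OF A S] by (auto simp: B_def)
    then show False using cSup_upper[OF _ \<open>bdd_above B\<close>] by fastforce
  qed
  then have "lam \<le> Sup B" by (intro spec) (simp add: op_spectrum_def)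
  then have "lam * (l2_norm L u)\<^sup>2 \<le> Sup B * (l2_norm L u)\<^sup>2" for u
    by (intro mult_right_mono) auto
  then show ?thesis using S unfolding lower_bound_def by (fastforce intro: order_trans)
qed

text \<open>Joint continuity of the inner product in quantitative form. The bound mentions only the
  limits \<open>f\<close> and \<open>g\<close>, so it tends to 0 with \<open>e\<close> whatever
  approximants are chosen.\<close>

lemma l2_inner_dist_le:
  assumes "f \<in> l2_functions L" "g \<in> l2_functions L" "u \<in> l2_functions L" "v \<in> l2_functions L"
    and "l2_norm L (\<lambda>x. f x - u x) \<le> e" "l2_norm L (\<lambda>x. g x - v x) \<le> e" "0 \<le> e"
  shows "norm (l2_inner L f g - l2_inner L u v) \<le> e * (l2_norm L f + l2_norm L g + e)"
proof -
  have "l2_norm L v \<le> l2_norm L g + l2_norm L (\<lambda>x. v x - g x)"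
    using l2_norm_triangle[OF assms(2) l2_diff[OF assms(4,2)]] by simp
  then have v: "l2_norm L v \<le> l2_norm L g + e"
    using assms(6) l2_norm_minus_commute[of L v g] by linarith
  have "l2_inner L f g - l2_inner L u v
      = l2_inner L f (\<lambda>x. g x - v x) + l2_inner L (\<lambda>x. f x - u x) v"
    using assms by (simp add: l2_inner_diff_left l2_inner_diff_right)
  then have "norm (l2_inner L f g - l2_inner L u v) \<le> norm (l2_inner L f (\<lambda>x. g x - v x))
      + norm (l2_inner L (\<lambda>x. f x - u x) v)"
    by (simp add: norm_triangle_ineq)
  also have "\<dots> \<le> l2_norm L f * l2_norm L (\<lambda>x. g x - v x) + l2_norm L (\<lambda>x. f x - u x) * l2_norm L v"
    using assms by (intro add_mono l2_cauchy_schwarz l2_diff)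
  also have "\<dots> \<le> l2_norm L f * e + e * (l2_norm L g + e)"
    using assms v by (intro add_mono mult_mono l2_norm_nonneg) auto
  finally show ?thesis by (simp add: algebra_simps)
qed

text \<open>Both sides of the inequality are continuous under convergence of vector and image
  together, which is the convergence that defines the closure.\<close>

lemma lower_bound_closure:
  assumes T: "T \<subseteq> l2_functions L \<times> l2_functions L" and c: "lower_bound L T c"
  shows "lower_bound L (op_closure L T) c"
proof -
  have "c * (l2_norm L f)\<^sup>2 \<le> Re (l2_inner L f g)" if fg: "(f, g) \<in> op_closure L T" for f g
  proof -
    have L: "f \<in> l2_functions L" "g \<in> l2_functions L" using fg by (auto simp: op_closure_def)
    \<comment> \<open>The total error of passing to an approximant in \<open>T\<close>: one term for
      the form, one, weighted by the absolute value of \<open>c\<close>, for the squared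
      norm.\<close>
    define K where "K e = e * (l2_norm L f + l2_norm L g + e) + \<bar>c\<bar> * (e * (l2_norm L f + l2_norm L f + e))" for e
    have "c * (l2_norm L f)\<^sup>2 \<le> Re (l2_inner L f g) + K e" if "e > 0" for e
    proof -
      obtain u v where uv: "(u, v) \<in> T" "l2_norm L (\<lambda>x. f x - u x) < e" "l2_norm L (\<lambda>x. g x - v x) < e"
        using fg \<open>e > 0\<close> unfolding op_closure_def by blast
      then have uL: "u \<in> l2_functions L" "v \<in> l2_functions L" using T by auto
      have 1: "norm (l2_inner L f g - l2_inner L u v) \<le> e * (l2_norm L f + l2_norm L g + e)"
        using uv L uL \<open>e > 0\<close> by (intro l2_inner_dist_le) auto
      have "norm (l2_inner L f f - l2_inner L u u) \<le> e * (l2_norm L f + l2_norm L f + e)"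
        using uv L uL \<open>e > 0\<close> by (intro l2_inner_dist_le) auto
      then have "\<bar>(l2_norm L f)\<^sup>2 - (l2_norm L u)\<^sup>2\<bar> \<le> e * (l2_norm L f + l2_norm L f + e)"
        unfolding l2_inner_self by (simp flip: of_real_diff del: of_real_power)
      then have "\<bar>c\<bar> * \<bar>(l2_norm L f)\<^sup>2 - (l2_norm L u)\<^sup>2\<bar> \<le> \<bar>c\<bar> * (e * (l2_norm L f + l2_norm L f + e))"
        by (rule mult_left_mono) simp
      moreover have "c * ((l2_norm L f)\<^sup>2 - (l2_norm L u)\<^sup>2) \<le> \<bar>c\<bar> * \<bar>(l2_norm L f)\<^sup>2 - (l2_norm L u)\<^sup>2\<bar>"
        using abs_ge_self[of "c * ((l2_norm L f)\<^sup>2 - (l2_norm L u)\<^sup>2)"] by (simp only: abs_mult)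
      moreover have "c * (l2_norm L u)\<^sup>2 \<le> Re (l2_inner L u v)"
        using c uv(1) unfolding lower_bound_def by blast
      moreover have "Re (l2_inner L u v) - Re (l2_inner L f g) \<le> norm (l2_inner L f g - l2_inner L u v)"
        using abs_Re_le_cmod[of "l2_inner L f g - l2_inner L u v"] by (simp add: abs_le_iff)
      ultimately show ?thesis
        using 1 unfolding K_def right_diff_distrib by linarith
    qed
    then have "\<forall>\<^sub>F e in at_right 0. c * (l2_norm L f)\<^sup>2 \<le> Re (l2_inner L f g) + K e"
      by (auto simp: eventually_at_filter)
    moreover have "((\<lambda>e. Re (l2_inner L f g) + K e) \<longlongrightarrow> Re (l2_inner L f g) + K 0) (at_right 0)"
      unfolding K_def by (intro tendsto_intros)
    ultimately have "c * (l2_norm L f)\<^sup>2 \<le> Re (l2_inner L f g) + K 0"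
      by (intro tendsto_lowerbound) auto
    then show ?thesis by (simp add: K_def)
  qed
  then show ?thesis unfolding lower_bound_def by blast
qed

lemma subset_op_closure:
  assumes "T \<subseteq> l2_functions L \<times> l2_functions L"
  shows "T \<subseteq> op_closure L T"
proof -
  have "l2_norm L (\<lambda>x. f x - f x) = 0" for f by (simp add: l2_norm_def)
  then have "\<exists>(u, v)\<in>T. l2_norm L (\<lambda>x. f x - u x) < e \<and> l2_norm L (\<lambda>x. g x - v x) < e"
    if "(f, g) \<in> T" "e > 0" for f g e
    by (intro bexI[OF _ that(1)]) (simp add: that(2))
  then show ?thesis using assms unfolding op_closure_def by blast
qed

subsection \<open>Trigonometric polynomials\<close>

lemma has_vector_derivative_exp_mult:
  "((\<lambda>x. exp (a * complex_of_real x)) has_vector_derivative a * exp (a * complex_of_real x))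
    (at x within S)"
proof -
  have "((\<lambda>w. exp (a * w)) has_field_derivative a * exp (a * complex_of_real x))
     (at (complex_of_real x))"
    by (auto intro!: derivative_eq_intros)
  then show ?thesis by (rule has_vector_derivative_real_field)
qed

lemma integral_lebesgue_on_FTC:
  fixes F :: "real \<Rightarrow> 'a::euclidean_space"
  assumes "a \<le> b" and "continuous_on {a..b} f"
    and "\<And>x. x \<in> {a..b} \<Longrightarrow> (F has_vector_derivative f x) (at x within {a..b})"
  shows "(\<integral>x. f x \<partial>lebesgue_on {a..b}) = F b - F a"
  using lebesgue_integral_eq_integral[OF continuous_imp_integrable_real[OF assms(2)]]
    integral_unique[OF fundamental_theorem_of_calculus[OF assms(1,3)]] by simp

lemma integral_lebesgue_on_cong:
  assumes "\<And>x. x \<in> {a..b} \<Longrightarrow> f x = g x"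
  shows "(\<integral>x. f x \<partial>lebesgue_on {a..b}) = (\<integral>x. g x \<partial>lebesgue_on {a..b::real})"
  using assms by (intro Bochner_Integration.integral_cong) auto

definition freq :: "real \<Rightarrow> int \<Rightarrow> complex" where
  "freq L n = of_real (2 * pi * of_int n / L)"

text \<open>The basis function before truncation. It is smooth on the whole line, so derivatives at
  the endpoints raise no question; \<open>zero_ext\<close> is applied only afterwards.\<close>

definition wave :: "real \<Rightarrow> int \<Rightarrow> real \<Rightarrow> complex" where
  "wave L n = (\<lambda>x. of_real (1 / sqrt L) * exp (\<i> * freq L n * of_real x))"

lemma trig_basis_eq: "trig_basis L n = zero_ext L (wave L n)"
  by (simp add: trig_basis_def wave_def freq_def mult_ac)

lemma has_vector_derivative_wave:
  "(wave L n has_vector_derivative \<i> * freq L n * wave L n x) (at x within S)"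
  unfolding wave_def
  by (rule has_vector_derivative_eq_rhs,
      rule has_vector_derivative_mult_right[OF has_vector_derivative_exp_mult]) simp

lemma continuous_on_wave: "continuous_on S (wave L n)"
  unfolding wave_def by (intro continuous_intros)

lemma wave_L: "L > 0 \<Longrightarrow> wave L n L = wave L n 0"
  using exp_integer_2pi[of "of_int n"] by (simp add: wave_def freq_def mult_ac)

lemma wave_0: "wave L n 0 = of_real (1 / sqrt L)"
  by (simp add: wave_def)

lemma zero_ext_in: "x \<in> {0..L} \<Longrightarrow> zero_ext L f x = f x"
  by (simp add: zero_ext_def)

lemma l2_functions_cong:
  assumes "\<And>x. x \<in> {0..L} \<Longrightarrow> f x = g x" "f \<in> l2_functions L"
  shows "g \<in> l2_functions L"
proof -
  have "g \<in> borel_measurable (lebesgue_on {0..L})"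
    using l2_measurable[OF assms(2)] assms(1)
    by (subst measurable_cong[where g = f]) auto
  moreover have "integrable (lebesgue_on {0..L}) (\<lambda>x. (norm (g x))\<^sup>2)"
    using l2_integrable_square[OF assms(2)] assms(1)
    by (subst Bochner_Integration.integrable_cong[where g = "\<lambda>x. (norm (f x))\<^sup>2"]) auto
  ultimately show ?thesis by (simp add: l2_functions_def)
qed

lemma l2_zero_ext_continuous: "continuous_on {0..L} f \<Longrightarrow> zero_ext L f \<in> l2_functions L"
  by (rule l2_functions_cong[OF _ l2_continuous]) (simp_all add: zero_ext_in)

lemma trig_basis_l2: "trig_basis L n \<in> l2_functions L"
  unfolding trig_basis_eq by (intro l2_zero_ext_continuous continuous_on_wave)

section \<open>The space of trigonometric polynomials\<close>

lemma trig_polys_sum: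
  "finite S \<Longrightarrow> (\<lambda>x. \<Sum>n\<in>S. c n * trig_basis L n x) \<in> trig_polys L"
  unfolding trig_polys_def by blast

lemma trig_basis_in_trig_polys: "trig_basis L n \<in> trig_polys L"
  using trig_polys_sum[of "{n}" "\<lambda>_. 1" L] by simp

lemma trig_polys_scale:
  assumes "p \<in> trig_polys L" shows "(\<lambda>x. a * p x) \<in> trig_polys L"
proof -
  obtain S c where p: "finite S" "p = (\<lambda>x. \<Sum>n\<in>S. c n * trig_basis L n x)"
    using assms by (auto simp: trig_polys_def)
  show ?thesis
    using trig_polys_sum[OF p(1), of "\<lambda>n. a * c n" L] by (simp add: p(2) sum_distrib_left mult.assoc)
qed

lemma trig_polys_add:
  assumes "p \<in> trig_polys L" "q \<in> trig_polys L"
  shows "(\<lambda>x. p x + q x) \<in> trig_polys L"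
proof -
  obtain S c where p: "finite S" "p = (\<lambda>x. \<Sum>n\<in>S. c n * trig_basis L n x)"
    using assms by (auto simp: trig_polys_def)
  obtain S' c' where q: "finite S'" "q = (\<lambda>x. \<Sum>n\<in>S'. c' n * trig_basis L n x)"
    using assms by (auto simp: trig_polys_def)
  define d where "d n = (if n \<in> S then c n else 0) + (if n \<in> S' then c' n else 0)" for n
  have "p x + q x = (\<Sum>n\<in>S \<union> S'. d n * trig_basis L n x)" for x
  proof -
    have "p x = (\<Sum>n\<in>S \<union> S'. (if n \<in> S then c n else 0) * trig_basis L n x)"
      unfolding p(2) by (rule sum.mono_neutral_cong_left) (use p(1) q(1) in auto)
    moreover have "q x = (\<Sum>n\<in>S \<union> S'. (if n \<in> S' then c' n else 0) * trig_basis L n x)"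
      unfolding q(2) by (rule sum.mono_neutral_cong_left) (use p(1) q(1) in auto)
    ultimately show ?thesis by (simp add: d_def distrib_right sum.distrib)
  qed
  then show ?thesis using trig_polys_sum[of "S \<union> S'" d L] p(1) q(1) by simp
qed

lemma l2_sum:
  "finite S \<Longrightarrow> (\<And>n. n \<in> S \<Longrightarrow> f n \<in> l2_functions L) \<Longrightarrow> (\<lambda>x. \<Sum>n\<in>S. f n x) \<in> l2_functions L"
proof (induction S rule: finite_induct)
  case empty
  show ?case using l2_scale[OF trig_basis_l2[of L 0], of 0] by simp
qed (auto intro: l2_add)

lemma trig_polys_l2: "p \<in> trig_polys L \<Longrightarrow> p \<in> l2_functions L"
  unfolding trig_polys_def by (auto intro!: l2_sum l2_scale trig_basis_l2)

text \<open>The modulus is \<open>exp (Im z * L)\<close>, which differs from 1 off the real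
  axis.\<close>

lemma exp_nonreal_ne_1:
  assumes "L > 0" "z \<notin> \<real>"
  shows "exp (- \<i> * z * complex_of_real L) \<noteq> 1"
  using assms by (auto simp: exp_eq_1 complex_is_Real_iff)

lemma freq_ne_nonreal: "z \<notin> \<real> \<Longrightarrow> freq L n \<noteq> z"
  by (auto simp: freq_def)

text \<open>By periodicity of the wave the integral is, up to \<open>1 / sqrt L\<close>, the
  quotient of \<open>exp (- i z L) - 1\<close> by \<open>i (freq L n - z)\<close>, and neither
  vanishes for nonreal \<open>z\<close>. This permits corrections by a multiple of
  \<open>trig_basis L 0\<close> and excludes single-frequency functions at the end.\<close>

lemma fourier_hat_trig_basis_ne_0:
  assumes "L > 0" "z \<notin> \<real>"
  shows "fourier_hat L (trig_basis L n) z \<noteq> 0"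
proof -
  define a where "a = \<i> * (freq L n - z)"
  have "a \<noteq> 0" using freq_ne_nonreal[OF assms(2)] by (simp add: a_def)
  have e: "wave L n x * exp (- \<i> * z * of_real x) = of_real (1 / sqrt L) * exp (a * of_real x)" for x
    by (simp add: wave_def a_def exp_add[symmetric] algebra_simps)
  have "fourier_hat L (trig_basis L n) z
      = (\<integral>x. of_real (1 / sqrt L) * exp (a * of_real x) \<partial>lebesgue_on {0..L})"
    unfolding fourier_hat_def
    by (rule integral_lebesgue_on_cong) (simp only: trig_basis_eq zero_ext_in e)
  also have "\<dots> = of_real (1 / sqrt L) * (exp (a * of_real L) / a) - of_real (1 / sqrt L) * (exp (a * of_real 0) / a)"
  proof (rule integral_lebesgue_on_FTC)
    fix x
    have "((\<lambda>x. of_real (1 / sqrt L) / a * exp (a * of_real x)) has_vector_derivative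
       of_real (1 / sqrt L) / a * (a * exp (a * of_real x))) (at x within {0..L})"
      by (intro has_vector_derivative_mult_right has_vector_derivative_exp_mult)
    then show "((\<lambda>x. of_real (1 / sqrt L) * (exp (a * of_real x) / a)) has_vector_derivative
       of_real (1 / sqrt L) * exp (a * of_real x)) (at x within {0..L})"
      using \<open>a \<noteq> 0\<close> by simp
  qed (use assms(1) in \<open>auto intro!: continuous_intros\<close>)
  also have "\<dots> = (wave L n L * exp (- \<i> * z * of_real L) - wave L n 0) / a"
    unfolding e by (simp add: wave_0 diff_divide_distrib)
  also have "\<dots> = of_real (1 / sqrt L) * (exp (- \<i> * z * of_real L) - 1) / a"
    using wave_L[OF assms(1)] by (simp add: wave_0 algebra_simps)
  finally show ?thesis
    using exp_nonreal_ne_1[OF assms] \<open>a \<noteq> 0\<close> assms(1) by simp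
qed

text \<open>
  A solution of \<open>H' - izH = p\<close> with \<open>H 0 = H L = 0\<close>: the periodic solution already vanishes at the
  endpoints, because \<open>\<integral>\<^sub>0\<^sup>L p(x) e\<^sup>-\<^sup>i\<^sup>z\<^sup>x dx = H(0) (e\<^sup>-\<^sup>i\<^sup>z\<^sup>L - 1)\<close>.
\<close>

lemma trig_poly_primitive:
  assumes "L > 0" "z \<notin> \<real>" and p: "p \<in> trig_polys L" and "fourier_hat L p z = 0"
  obtains H H' where "\<And>x S. (H has_vector_derivative H' x) (at x within S)"
    and "\<And>S. continuous_on S H'" and "H 0 = 0" and "H L = 0"
    and "p = zero_ext L (\<lambda>x. H' x - \<i> * z * H x)" and "zero_ext L H \<in> trig_polys L"
proof -
  obtain S c where S: "finite S" and p_eq: "p = (\<lambda>x. \<Sum>n\<in>S. c n * trig_basis L n x)"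
    using p by (auto simp: trig_polys_def)
  \<comment> \<open>On frequency \<open>n\<close> the operator \<open>d/dx - i z\<close> acts as
    multiplication by \<open>i (freq L n - z)\<close>, which is nonzero because \<open>z\<close> is
    nonreal.\<close>
  define b where "b n = c n / (\<i> * (freq L n - z))" for n
  define H where "H x = (\<Sum>n\<in>S. b n * wave L n x)" for x
  define H' where "H' x = (\<Sum>n\<in>S. b n * (\<i> * freq L n * wave L n x))" for x
  have dH: "(H has_vector_derivative H' x) (at x within T)" for x T
    unfolding H_def[abs_def] H'_def
    by (intro has_vector_derivative_sum has_vector_derivative_mult_right has_vector_derivative_wave)
  have cH': "continuous_on T H'" for T
    unfolding H'_def[abs_def] by (intro continuous_intros continuous_on_wave)
  have "b n * (\<i> * freq L n * wave L n x) - \<i> * z * (b n * wave L n x) = c n * wave L n x" for n x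
  proof -
    have c: "c n = b n * (\<i> * (freq L n - z))"
      using freq_ne_nonreal[OF assms(2)] by (simp add: b_def)
    show ?thesis unfolding c by (simp add: algebra_simps)
  qed
  then have P: "H' x - \<i> * z * H x = (\<Sum>n\<in>S. c n * wave L n x)" for x
    by (simp add: H_def H'_def sum_distrib_left flip: sum_subtractf)
  have pz: "p = zero_ext L (\<lambda>x. H' x - \<i> * z * H x)"
    unfolding P p_eq by (auto simp: trig_basis_eq zero_ext_def fun_eq_iff)
  have "zero_ext L H = (\<lambda>x. \<Sum>n\<in>S. b n * trig_basis L n x)"
    by (auto simp: H_def trig_basis_eq zero_ext_def fun_eq_iff)
  then have tH: "zero_ext L H \<in> trig_polys L" using trig_polys_sum[OF S] by simp
  have per: "H L = H 0" by (simp add: H_def wave_L[OF assms(1)])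
  have cH: "continuous_on T H" for T
    unfolding H_def[abs_def] by (intro continuous_intros continuous_on_wave)
  have "0 = (\<integral>x. (H' x - \<i> * z * H x) * exp (- \<i> * z * of_real x) \<partial>lebesgue_on {0..L})"
    unfolding assms(4)[symmetric] fourier_hat_def
    by (rule integral_lebesgue_on_cong) (simp only: pz zero_ext_in)
  also have "\<dots> = H L * exp (- \<i> * z * of_real L) - H 0 * exp (- \<i> * z * of_real 0)"
  proof (rule integral_lebesgue_on_FTC)
    fix x
    show "((\<lambda>x. H x * exp (- \<i> * z * of_real x)) has_vector_derivative
        (H' x - \<i> * z * H x) * exp (- \<i> * z * of_real x)) (at x within {0..L})"
      by (rule has_vector_derivative_eq_rhs,
          rule has_vector_derivative_mult[OF dH has_vector_derivative_exp_mult])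
        (simp add: algebra_simps)
  qed (use assms(1) in \<open>auto intro!: continuous_intros cH cH'\<close>)
  also have "\<dots> = H 0 * (exp (- \<i> * z * of_real L) - 1)"
    unfolding per by (simp add: algebra_simps)
  finally have "H 0 = 0" using exp_nonreal_ne_1[OF assms(1,2)] by simp
  then show ?thesis using that dH cH' pz tH per by metis
qed

text \<open>Integration by parts; the boundary terms vanish with \<open>H\<close> at both
  endpoints.\<close>

lemma l2_inner_wave_primitive:
  assumes "L > 0" and dH: "\<And>x S. (H has_vector_derivative H' x) (at x within S)"
    and cH': "\<And>S. continuous_on S H'" and H0: "H 0 = 0" "H L = 0"
  shows "l2_inner L (trig_basis L k) (zero_ext L (\<lambda>x. H' x - \<i> * z * H x))
     = \<i> * (freq L k - z) * l2_inner L (trig_basis L k) (zero_ext L H)"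
proof -
  have cH: "continuous_on S H" for S
    using dH by (meson continuous_on_vector_derivative)
  have f: "cnj (freq L k) = freq L k" by (simp add: freq_def)
  have dw: "((\<lambda>x. cnj (wave L k x)) has_vector_derivative - \<i> * freq L k * cnj (wave L k x)) (at x within S)"
    for x S
    using has_vector_derivative_cnj[OF has_vector_derivative_wave[of L k x S]] by (simp add: f)
  have cw: "continuous_on S (\<lambda>x. cnj (wave L k x))" for S
    by (intro continuous_intros continuous_on_wave)
  have i: "integrable (lebesgue_on {0..L}) (\<lambda>x. cnj (wave L k x) * G x)" if "continuous_on {0..L} G" for G
    by (intro continuous_imp_integrable_real continuous_intros cw that)
  have "l2_inner L (trig_basis L k) (zero_ext L (\<lambda>x. H' x - \<i> * z * H x))
      - \<i> * (freq L k - z) * l2_inner L (trig_basis L k) (zero_ext L H)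
    = (\<integral>x. cnj (wave L k x) * (H' x - \<i> * z * H x) \<partial>lebesgue_on {0..L})
      - \<i> * (freq L k - z) * (\<integral>x. cnj (wave L k x) * H x \<partial>lebesgue_on {0..L})"
    unfolding l2_inner_def trig_basis_eq
    by (intro arg_cong2[where f = "(-)"] arg_cong2[where f = "(*)"] integral_lebesgue_on_cong refl)
      (simp_all only: zero_ext_in)
  also have "\<dots> = (\<integral>x. cnj (wave L k x) * (H' x - \<i> * z * H x)
       - \<i> * (freq L k - z) * (cnj (wave L k x) * H x) \<partial>lebesgue_on {0..L})"
    by (subst Bochner_Integration.integral_diff)
      (auto intro!: i integrable_mult_right continuous_intros cH cH')
  also have "\<dots> = cnj (wave L k L) * H L - cnj (wave L k 0) * H 0"
  proof (rule integral_lebesgue_on_FTC)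
    fix x
    show "((\<lambda>x. cnj (wave L k x) * H x) has_vector_derivative
        cnj (wave L k x) * (H' x - \<i> * z * H x) - \<i> * (freq L k - z) * (cnj (wave L k x) * H x))
        (at x within {0..L})"
      by (rule has_vector_derivative_eq_rhs, rule has_vector_derivative_mult[OF dw dH])
        (simp add: algebra_simps)
  qed (use assms(1) in \<open>auto intro!: continuous_intros cH cH' continuous_on_wave\<close>)
  finally show ?thesis using H0 by simp
qed

lemma l2_inner_trig_basis:
  assumes "L > 0"
  shows "l2_inner L (trig_basis L m) (trig_basis L n) = (if m = n then 1 else 0)"
proof -
  define a where "a = \<i> * (freq L n - freq L m)"
  have e: "cnj (wave L m x) * wave L n x = of_real (1 / L) * exp (a * of_real x)" for x
    using assms by (simp add: wave_def a_def freq_def exp_cnj exp_add[symmetric] algebra_simps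
        flip: of_real_mult)
  have I: "l2_inner L (trig_basis L m) (trig_basis L n)
      = (\<integral>x. of_real (1 / L) * exp (a * of_real x) \<partial>lebesgue_on {0..L})"
    unfolding l2_inner_def
    by (rule integral_lebesgue_on_cong) (simp only: trig_basis_eq zero_ext_in e)
  show ?thesis
  proof (cases "m = n")
    case True
    then have "a = 0" by (simp add: a_def)
    then show ?thesis using I True assms by (simp add: measure_restrict_space scaleR_conv_of_real)
  next
    case False
    then have "a \<noteq> 0" using assms by (simp add: a_def freq_def)
    have "(\<integral>x. of_real (1 / L) * exp (a * of_real x) \<partial>lebesgue_on {0..L})
        = of_real (1 / L) * exp (a * of_real L) / a - of_real (1 / L) * exp (a * of_real 0) / a"
    proof (rule integral_lebesgue_on_FTC)
      fix x
      have "((\<lambda>x. of_real (1 / L) / a * exp (a * of_real x)) has_vector_derivative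
         of_real (1 / L) / a * (a * exp (a * of_real x))) (at x within {0..L})"
        by (intro has_vector_derivative_mult_right has_vector_derivative_exp_mult)
      then show "((\<lambda>x. of_real (1 / L) * exp (a * of_real x) / a) has_vector_derivative
         of_real (1 / L) * exp (a * of_real x)) (at x within {0..L})"
        using \<open>a \<noteq> 0\<close> by simp
    qed (use assms in \<open>auto intro!: continuous_intros\<close>)
    also have "\<dots> = (cnj (wave L m L) * wave L n L - cnj (wave L m 0) * wave L n 0) / a"
      unfolding e by (simp add: diff_divide_distrib)
    also have "\<dots> = 0" by (simp add: wave_L[OF assms])
    finally show ?thesis using I False by simp
  qed
qed

subsection \<open>Replacing a zero by its conjugate\<close>

text \<open>Evaluation of the transform at a point is a bounded functional, so linearity and
  Cauchy-Schwarz for \<open>l2_inner\<close> apply to it.\<close>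

lemma fourier_hat_eq_l2_inner:
  "fourier_hat L f z = l2_inner L (\<lambda>x. cnj (exp (- \<i> * z * of_real x))) f"
  by (simp add: fourier_hat_def l2_inner_def mult.commute)

section \<open>The Volterra operator\<close>

lemma l2_exp: "(\<lambda>x. exp (a * of_real x)) \<in> l2_functions L"
  by (intro l2_continuous continuous_intros)

lemma l2_cnj_exp: "(\<lambda>x. cnj (exp (a * of_real x))) \<in> l2_functions L"
  by (intro l2_cnj l2_exp)

text \<open>Variation of constants for \<open>u' - i z u = f\<close> with \<open>u 0 = 0\<close>.
  The formula makes sense for every square-integrable \<open>f\<close>, so limits of trigonometric
  polynomials can be taken in it.\<close>

definition volterra :: "complex \<Rightarrow> (real \<Rightarrow> complex) \<Rightarrow> real \<Rightarrow> complex" where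
  "volterra z f x = exp (\<i> * z * of_real x) * integral {0..x} (\<lambda>t. f t * exp (- \<i> * z * of_real t))"

lemma volterra_integrable:
  assumes "f \<in> l2_functions L" "x \<le> L"
  shows "(\<lambda>t. f t * exp (- \<i> * z * of_real t)) integrable_on {0..x}"
proof -
  have "(\<lambda>t. f t * exp (- \<i> * z * of_real t)) integrable_on {0..L}"
    by (rule integrable_on_lebesgue_on[OF l2_integrable_mult[OF assms(1) l2_exp]]) simp
  then show ?thesis by (rule integrable_subinterval_real) (use assms in auto)
qed

lemma volterra_continuous_on:
  assumes "f \<in> l2_functions L"
  shows "continuous_on {0..L} (volterra z f)"
  unfolding volterra_def[abs_def]
  by (intro continuous_intros indefinite_integral_continuous_1 volterra_integrable[OF assms]) simp

lemma volterra_l2: "f \<in> l2_functions L \<Longrightarrow> volterra z f \<in> l2_functions L"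
  by (rule l2_continuous[OF volterra_continuous_on])

lemma volterra_diff:
  assumes "f \<in> l2_functions L" "g \<in> l2_functions L" "x \<in> {0..L}"
  shows "volterra z (\<lambda>x. f x - g x) x = volterra z f x - volterra z g x"
  using volterra_integrable[OF assms(1), of x z] volterra_integrable[OF assms(2), of x z] assms(3)
  by (simp add: volterra_def left_diff_distrib right_diff_distrib Henstock_Kurzweil_Integration.integral_diff)

lemma l2_norm_le_sup:
  assumes "L > 0" "f \<in> l2_functions L" "B \<ge> 0" "\<And>x. x \<in> {0..L} \<Longrightarrow> norm (f x) \<le> B"
  shows "l2_norm L f \<le> B * sqrt L"
proof (rule power2_le_imp_le)
  have "(\<integral>x. (norm (f x))\<^sup>2 \<partial>lebesgue_on {0..L}) \<le> (\<integral>x. B\<^sup>2 \<partial>lebesgue_on {0..L})"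
    using assms by (intro Bochner_Integration.integral_mono l2_integrable_square
        continuous_imp_integrable_real continuous_intros power_mono) auto
  also have "\<dots> = L * B\<^sup>2"
    using assms(1) by (simp add: measure_restrict_space)
  finally show "(l2_norm L f)\<^sup>2 \<le> (B * sqrt L)\<^sup>2"
    using assms(1) by (simp add: l2_norm_square power_mult_distrib mult.commute)
qed (use assms in simp)

text \<open>Cauchy-Schwarz bounds the inner integral uniformly in \<open>x\<close>, and the outer
  exponential is at most \<open>exp (\<bar>Im z\<bar> * L)\<close>; a uniform bound on an interval
  of length \<open>L\<close> gives one in norm.\<close>

lemma volterra_bounded:
  assumes "L > 0"
  obtains K where "K \<ge> 0" "\<And>f. f \<in> l2_functions L \<Longrightarrow> l2_norm L (volterra z f) \<le> K * l2_norm L f"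
proof
  define c where "c = l2_norm L (\<lambda>x. exp (- \<i> * z * of_real x))"
  have "c \<ge> 0" by (simp add: c_def l2_norm_nonneg)
  show "exp (\<bar>Im z\<bar> * L) * c * sqrt L \<ge> 0"
    using assms \<open>c \<ge> 0\<close> by simp
  fix f assume f: "f \<in> l2_functions L"
  have "norm (volterra z f x) \<le> exp (\<bar>Im z\<bar> * L) * (c * l2_norm L f)" if x: "x \<in> {0..L}" for x
  proof -
    let ?h = "\<lambda>t. f t * exp (- \<i> * z * of_real t)"
    have ih: "integrable (lebesgue_on {0..L}) (\<lambda>t. norm (?h t))"
      by (intro integrable_norm l2_integrable_mult[OF f l2_exp])
    have n: "(\<lambda>t. norm (?h t)) integrable_on {0..L}"
      by (rule integrable_on_lebesgue_on[OF ih]) simp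
    then have n': "(\<lambda>t. norm (?h t)) integrable_on {0..x}"
      by (rule integrable_subinterval_real) (use x in auto)
    have "norm (integral {0..x} ?h) \<le> integral {0..x} (\<lambda>t. norm (?h t))"
      using volterra_integrable[OF f, of x z] n' x by (intro integral_norm_bound_integral) auto
    also have "\<dots> \<le> integral {0..L} (\<lambda>t. norm (?h t))"
      using n n' x by (intro integral_subset_le) auto
    also have "\<dots> = (\<integral>t. norm (f t) * norm (exp (- \<i> * z * of_real t)) \<partial>lebesgue_on {0..L})"
      using lebesgue_integral_eq_integral[OF ih] by (simp add: norm_mult)
    also have "\<dots> \<le> c * l2_norm L f"
      using l2_integral_norm_mult_le[OF f l2_exp[of "- \<i> * z"]] by (simp only: c_def mult.commute)
    finally have 1: "norm (integral {0..x} ?h) \<le> c * l2_norm L f" .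
    have "- (Im z * x) \<le> \<bar>Im z\<bar> * x" using x by (simp add: abs_if mult_right_mono)
    also have "\<dots> \<le> \<bar>Im z\<bar> * L" using x by (intro mult_left_mono) auto
    finally have 2: "norm (exp (\<i> * z * of_real x)) \<le> exp (\<bar>Im z\<bar> * L)"
      by (simp add: norm_exp_eq_Re)
    show ?thesis
      unfolding volterra_def norm_mult using 1 2 by (intro mult_mono) auto
  qed
  then have "l2_norm L (volterra z f) \<le> exp (\<bar>Im z\<bar> * L) * (c * l2_norm L f) * sqrt L"
    using assms \<open>c \<ge> 0\<close>
    by (intro l2_norm_le_sup volterra_l2 f mult_nonneg_nonneg l2_norm_nonneg) auto
  then show "l2_norm L (volterra z f) \<le> exp (\<bar>Im z\<bar> * L) * c * sqrt L * l2_norm L f"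
    by (simp add: mult_ac)
qed

text \<open>The integrand is the derivative of \<open>H t * exp (- i z t)\<close>, and
  \<open>H 0 = 0\<close> is the initial condition built into \<open>volterra\<close>. Hence the
  primitive found in \<open>trig_poly_primitive\<close> is the Volterra image.\<close>

lemma volterra_primitive:
  assumes dH: "\<And>x S. (H has_vector_derivative H' x) (at x within S)" and "H 0 = 0"
    and x: "x \<in> {0..L}"
  shows "volterra z (zero_ext L (\<lambda>x. H' x - \<i> * z * H x)) x = H x"
proof -
  have "((\<lambda>t. (H' t - \<i> * z * H t) * exp (- \<i> * z * of_real t)) has_integral
      H x * exp (- \<i> * z * of_real x) - H 0 * exp (- \<i> * z * of_real 0)) {0..x}"
  proof (rule fundamental_theorem_of_calculus)
    fix t
    show "((\<lambda>x. H x * exp (- \<i> * z * of_real x)) has_vector_derivative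
        (H' t - \<i> * z * H t) * exp (- \<i> * z * of_real t)) (at t within {0..x})"
      by (rule has_vector_derivative_eq_rhs,
          rule has_vector_derivative_mult[OF dH has_vector_derivative_exp_mult])
        (simp add: algebra_simps)
  qed (use x in auto)
  then have "((\<lambda>t. zero_ext L (\<lambda>x. H' x - \<i> * z * H x) t * exp (- \<i> * z * of_real t)) has_integral
      H x * exp (- \<i> * z * of_real x)) {0..x}"
    by (rule has_integral_eq_rhs[OF has_integral_eq[rotated]]) (use x assms(2) in \<open>auto simp: zero_ext_def\<close>)
  then show ?thesis
    by (simp add: volterra_def integral_unique flip: exp_add)
qed

text \<open>
  On the Fourier side, passing from \<open>H' - izH\<close> to \<open>H' - i(cnj z)H\<close> multiplies the transform by a
  factor of modulus \<open>1\<close> on the real line. On the interval, the two integrands differ by the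
  derivative of a multiple of \<open>x \<mapsto> cnj (H (- x)) * H (y - x)\<close>, which vanishes at both ends of the overlap
  of the supports.
\<close>

lemma autocorrelation_conjugate_zero:
  fixes z :: complex
  assumes dH: "\<And>x S. (H has_vector_derivative H' x) (at x within S)"
    and cH': "\<And>S. continuous_on S H'" and H0: "H 0 = 0" "H L = 0"
  defines "f \<equiv> zero_ext L (\<lambda>x. H' x - \<i> * z * H x)"
    and "g \<equiv> zero_ext L (\<lambda>x. H' x - \<i> * cnj z * H x)"
  shows "convolution (star f) f = convolution (star g) g"
proof
  fix y
  define P where "P w x = H' x - \<i> * w * H x" for w x
  define I where "I w x = cnj (P w (- x)) * P w (y - x)" for w x
  \<comment> \<open>The first factor lives on \<open>[-L, 0]\<close>, the second on
    \<open>[y - L, y]\<close>; they overlap in \<open>[a, b]\<close>. If \<open>a > b\<close>, both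
    convolutions are 0 at \<open>y\<close>.\<close>
  define a where "a = max (- L) (y - L)"
  define b where "b = min 0 y"
  have cH: "continuous_on S H" for S
    using dH by (meson continuous_on_vector_derivative)
  have cr: "continuous_on S (\<lambda>x. F (- x))" "continuous_on S (\<lambda>x. F (y - x))"
    if "\<And>S. continuous_on S F" for S and F :: "real \<Rightarrow> complex"
    by (rule continuous_on_compose2[OF that[of UNIV]]; auto intro!: continuous_intros)+
  have cI: "continuous_on S (I w)" for S w
    unfolding I_def[abs_def] P_def by (intro continuous_intros cr cH cH')
  have conv: "convolution (star (zero_ext L (P w))) (zero_ext L (P w)) y
     = (\<integral>x. indicator {a..b} x *\<^sub>R I w x \<partial>lborel)" for w
    unfolding convolution_def star_def I_def
    by (intro Bochner_Integration.integral_cong)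
      (auto simp: zero_ext_def a_def b_def indicator_def)
  have "(\<integral>x. indicator {a..b} x *\<^sub>R I z x \<partial>lborel) = (\<integral>x. indicator {a..b} x *\<^sub>R I (cnj z) x \<partial>lborel)"
  proof (cases "a \<le> b")
    case True
    have int: "integrable lborel (\<lambda>x. indicator {a..b} x *\<^sub>R I w x)" for w
      by (rule borel_integrable_compact[OF compact_Icc cI])
    define F where "F x = \<i> * (z - cnj z) * (cnj (H (- x)) * H (y - x))" for x
    have d: "((\<lambda>x. H (c - x)) has_vector_derivative - H' (c - x)) (at x within S)" for c x S
    proof -
      have "((\<lambda>x. c - x) has_vector_derivative - 1) (at x within S)"
        by (auto intro!: derivative_eq_intros)
      from vector_diff_chain_within[OF this dH] show ?thesis by (simp add: o_def)
    qed
    have "(\<integral>x. indicator {a..b} x *\<^sub>R (I z x - I (cnj z) x) \<partial>lborel) = F b - F a"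
    proof (rule integral_FTC_Icc[OF True])
      fix x
      show "(F has_vector_derivative I z x - I (cnj z) x) (at x within {a..b})"
        unfolding F_def[abs_def]
        by (rule has_vector_derivative_eq_rhs,
            rule has_vector_derivative_mult_right,
            rule has_vector_derivative_mult[OF has_vector_derivative_cnj[OF d[of 0, simplified]] d])
          (simp add: I_def P_def algebra_simps)
    qed (intro continuous_intros cI)
    \<comment> \<open>At \<open>b\<close> one of the two arguments of \<open>H\<close> is 0, at
      \<open>a\<close> one of them is \<open>L\<close>.\<close>
    also have "F b = 0" using H0 by (auto simp: F_def b_def min_def)
    also have "F a = 0" using H0 by (auto simp: F_def a_def max_def)
    finally show ?thesis
      using int by (simp add: scaleR_diff_right)
  qed auto
  then show "convolution (star f) f y = convolution (star g) g y"
    using conv[of z] conv[of "cnj z"] by (simp add: f_def g_def P_def[abs_def])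
qed

text \<open>The autocorrelation identity at \<open>y = 0\<close>, redone on \<open>[0, L]\<close>:
  the integrands differ by the derivative of a multiple of the squared modulus of
  \<open>H\<close>.\<close>

lemma l2_norm_conjugate_zero:
  assumes "L > 0" and dH: "\<And>x S. (H has_vector_derivative H' x) (at x within S)"
    and cH': "\<And>S. continuous_on S H'" and H0: "H 0 = 0" "H L = 0"
  shows "l2_norm L (zero_ext L (\<lambda>x. H' x - \<i> * z * H x))
    = l2_norm L (zero_ext L (\<lambda>x. H' x - \<i> * cnj z * H x))"
proof -
  define P where "P w x = H' x - \<i> * w * H x" for w x
  have cH: "continuous_on S H" for S
    using dH by (meson continuous_on_vector_derivative)
  have cP: "continuous_on S (P w)" for S w
    unfolding P_def[abs_def] by (intro continuous_intros cH cH')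
  have i: "integrable (lebesgue_on {0..L}) (\<lambda>x. cnj (P w x) * P w x)" for w
    by (intro continuous_imp_integrable_real continuous_intros cP)
  have e: "l2_inner L (zero_ext L (P w)) (zero_ext L (P w)) = (\<integral>x. cnj (P w x) * P w x \<partial>lebesgue_on {0..L})"
    for w unfolding l2_inner_def by (rule integral_lebesgue_on_cong) (simp only: zero_ext_in)
  define F where "F x = \<i> * (cnj z - z) * (cnj (H x) * H x)" for x
  have "(\<integral>x. cnj (P z x) * P z x - cnj (P (cnj z) x) * P (cnj z) x \<partial>lebesgue_on {0..L}) = F L - F 0"
  proof (rule integral_lebesgue_on_FTC)
    fix x
    show "(F has_vector_derivative cnj (P z x) * P z x - cnj (P (cnj z) x) * P (cnj z) x)
        (at x within {0..L})"
      unfolding F_def[abs_def]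
      by (rule has_vector_derivative_eq_rhs,
          rule has_vector_derivative_mult_right,
          rule has_vector_derivative_mult[OF has_vector_derivative_cnj[OF dH] dH])
        (simp add: P_def algebra_simps)
  qed (use assms(1) in \<open>auto intro!: continuous_intros cP\<close>)
  then have "l2_inner L (zero_ext L (P z)) (zero_ext L (P z))
      = l2_inner L (zero_ext L (P (cnj z))) (zero_ext L (P (cnj z)))"
    unfolding e using i[of z] i[of "cnj z"] H0 by (simp add: F_def)
  then have "(l2_norm L (zero_ext L (P z)))\<^sup>2 = (l2_norm L (zero_ext L (P (cnj z))))\<^sup>2"
    unfolding l2_inner_self of_real_eq_iff .
  then have "l2_norm L (zero_ext L (P z)) = l2_norm L (zero_ext L (P (cnj z)))"
    by (rule power2_eq_imp_eq) (simp_all add: l2_norm_nonneg)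
  then show ?thesis by (simp add: P_def[abs_def])
qed

subsection \<open>Ground states\<close>

lemma operator_of_form_domain:
  assumes "operator_of_form L D T" "p \<in> trig_polys L"
  obtains v where "(p, v) \<in> T"
proof -
  have "p \<in> op_domain T"
    using assms trig_polys_l2[OF assms(2)] unfolding operator_of_form_def
    by (auto simp: l2_eq_def)
  then show ?thesis using that by (auto simp: op_domain_def)
qed

text \<open>Elements of the domain of \<open>T\<close> equal trigonometric polynomials only almost
  everywhere; invariance of the graph under null sets allows an honest one to be chosen.\<close>

lemma op_closure_approx_trig_poly:
  assumes T: "operator_of_form L D T" and fg: "(f, g) \<in> op_closure L T" and "e > 0"
  obtains p v where "(p, v) \<in> T" "p \<in> trig_polys L"
    "l2_norm L (\<lambda>x. f x - p x) < e" "l2_norm L (\<lambda>x. g x - v x) < e"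
proof -
  have op: "l2_operator L T" using T by (simp add: operator_of_form_def)
  note l2 = l2_operatorD(1)[OF op]
  obtain u v where uv: "(u, v) \<in> T" "l2_norm L (\<lambda>x. f x - u x) < e" "l2_norm L (\<lambda>x. g x - v x) < e"
    using fg \<open>e > 0\<close> unfolding op_closure_def by blast
  then have "u \<in> op_domain T" by (auto simp: op_domain_def)
  then obtain p where p: "p \<in> trig_polys L" "l2_eq L u p"
    using T unfolding operator_of_form_def by blast
  have L: "u \<in> l2_functions L" "v \<in> l2_functions L" "p \<in> l2_functions L" "f \<in> l2_functions L"
    using uv l2 p trig_polys_l2 fg by (auto simp: op_closure_def)
  have "(p, v) \<in> T"
    by (rule l2_operatorD(2)[OF op uv(1) L(3,2) p(2)]) (simp add: l2_eq_def)
  moreover have "l2_norm L (\<lambda>x. f x - p x) = l2_norm L (\<lambda>x. f x - u x)"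
    using p(2) by (intro l2_norm_cong l2_diff L) (auto simp: l2_eq_def)
  ultimately show ?thesis using that uv p by simp
qed

text \<open>Subtract from an approximant the multiple of \<open>trig_basis L 0\<close> that cancels
  its transform at \<open>z\<close>. That transform is small because the one of \<open>f\<close>
  vanishes at \<open>z\<close>, so the correction is small together with its image under
  \<open>T\<close>.\<close>

lemma op_closure_approx_zero:
  assumes "L > 0" "z \<notin> \<real>" and T: "operator_of_form L D T" and fg: "(f, g) \<in> op_closure L T"
    and f0: "fourier_hat L f z = 0" and "e > 0"
  obtains p v where "(p, v) \<in> T" "p \<in> trig_polys L" "fourier_hat L p z = 0"
    "l2_norm L (\<lambda>x. f x - p x) < e" "l2_norm L (\<lambda>x. g x - v x) < e"
proof -
  have op: "l2_operator L T" using T by (simp add: operator_of_form_def)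
  note l2 = l2_operatorD(1)[OF op]
  let ?E = "\<lambda>x. cnj (exp (- \<i> * z * complex_of_real x))"
  define q where "q = trig_basis L 0"
  have q: "q \<in> trig_polys L" by (simp add: q_def trig_basis_in_trig_polys)
  then obtain r where r: "(q, r) \<in> T" using operator_of_form_domain[OF T] by blast
  define s where "s = fourier_hat L q z"
  have "s \<noteq> 0" using fourier_hat_trig_basis_ne_0[OF assms(1,2)] by (simp add: s_def q_def)
  \<comment> \<open>The correction costs at most \<open>K\<close> times the initial error in either
    component, hence the tolerance \<open>e / (1 + K)\<close>.\<close>
  define K where "K = l2_norm L ?E / norm s * (l2_norm L q + l2_norm L r)"
  have "K \<ge> 0" by (simp add: K_def l2_norm_nonneg)
  then have "e / (1 + K) > 0" using \<open>e > 0\<close> by simp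
  then obtain p v where pv: "(p, v) \<in> T" "p \<in> trig_polys L"
    "l2_norm L (\<lambda>x. f x - p x) < e / (1 + K)" "l2_norm L (\<lambda>x. g x - v x) < e / (1 + K)"
    using op_closure_approx_trig_poly[OF T fg] by blast
  have L: "p \<in> l2_functions L" "v \<in> l2_functions L" "q \<in> l2_functions L" "r \<in> l2_functions L"
    "f \<in> l2_functions L" "g \<in> l2_functions L"
    using pv r l2 fg by (auto simp: op_closure_def)
  define t where "t = fourier_hat L p z / s"
  have "norm (fourier_hat L p z) \<le> l2_norm L ?E * l2_norm L (\<lambda>x. f x - p x)"
  proof -
    have "norm (l2_inner L ?E (\<lambda>x. f x - p x)) \<le> l2_norm L ?E * l2_norm L (\<lambda>x. f x - p x)"
      by (intro l2_cauchy_schwarz l2_diff L l2_cnj_exp)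
    moreover have "l2_inner L ?E (\<lambda>x. f x - p x) = - fourier_hat L p z"
      using f0 l2_inner_diff_right[OF l2_cnj_exp L(5,1), of "- \<i> * z"]
      by (simp add: fourier_hat_eq_l2_inner)
    ultimately show ?thesis by simp
  qed
  also have "\<dots> \<le> l2_norm L ?E * (e / (1 + K))"
    using pv by (intro mult_left_mono l2_norm_nonneg) simp
  finally have t: "norm t \<le> l2_norm L ?E / norm s * (e / (1 + K))"
    unfolding t_def norm_divide times_divide_eq_left by (rule divide_right_mono) simp
  \<comment> \<open>One estimate for both components: \<open>j\<close> will be \<open>q\<close> for
    the vector and \<open>r\<close> for its image.\<close>
  have close: "l2_norm L (\<lambda>x. h x - (k x + - t * j x)) < e"
    if "h \<in> l2_functions L" "k \<in> l2_functions L" "j \<in> l2_functions L"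
      "l2_norm L (\<lambda>x. h x - k x) < e / (1 + K)" "l2_norm L j \<le> l2_norm L q + l2_norm L r" for h k j
  proof -
    have "l2_norm L (\<lambda>x. (h x - k x) + t * j x) \<le> l2_norm L (\<lambda>x. h x - k x) + norm t * l2_norm L j"
      using l2_norm_triangle[OF l2_diff[OF that(1,2)] l2_scale[OF that(3), of t]]
      by (simp add: l2_norm_scale)
    also have "\<dots> < e / (1 + K) + (l2_norm L ?E / norm s * (e / (1 + K))) * (l2_norm L q + l2_norm L r)"
      using that t order_trans[OF norm_ge_zero t] by (intro add_less_le_mono mult_mono l2_norm_nonneg) auto
    also have "\<dots> = e / (1 + K) + e / (1 + K) * (l2_norm L ?E / norm s * (l2_norm L q + l2_norm L r))"
      by (simp only: mult_ac)
    also have "\<dots> = e / (1 + K) * (1 + K)"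
      unfolding K_def[symmetric] by (simp only: distrib_left mult_1_right)
    also have "\<dots> = e" using \<open>K \<ge> 0\<close> by simp
    finally show ?thesis by (simp add: algebra_simps)
  qed
  let ?p = "\<lambda>x. p x + - t * q x" and ?v = "\<lambda>x. v x + - t * r x"
  show ?thesis
  proof (rule that)
    show "(?p, ?v) \<in> T"
      by (intro l2_operatorD(3,4)[OF op] pv(1) r)
    show "?p \<in> trig_polys L" by (intro trig_polys_add trig_polys_scale pv(2) q)
    show "fourier_hat L ?p z = 0"
      using l2_inner_add_right[OF l2_cnj_exp L(1) l2_scale[OF L(3)], of "- \<i> * z" "- t"] \<open>s \<noteq> 0\<close>
      unfolding fourier_hat_eq_l2_inner l2_inner_scale_right
      by (simp add: t_def s_def fourier_hat_eq_l2_inner)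
    show "l2_norm L (\<lambda>x. f x - ?p x) < e"
      by (rule close) (use L pv l2_norm_nonneg in auto)
    show "l2_norm L (\<lambda>x. g x - ?v x) < e"
      by (rule close) (use L pv l2_norm_nonneg in auto)
  qed
qed

lemma nonpos_if_le_tendsto_0:
  fixes a :: real and \<omega> :: "real \<Rightarrow> real"
  assumes "\<And>e. e > 0 \<Longrightarrow> a \<le> \<omega> e" and "(\<omega> \<longlongrightarrow> 0) (at_right 0)"
  shows "a \<le> 0"
proof (rule tendsto_lowerbound[OF assms(2)])
  show "\<forall>\<^sub>F e in at_right 0. a \<le> \<omega> e"
    using assms(1) by (auto simp: eventually_at_filter)
qed simp

text \<open>For trigonometric polynomials whose transform vanishes at \<open>z\<close> this is
  integration by parts; both sides are continuous in \<open>f\<close>, since the Volterra operator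
  is bounded.\<close>

lemma l2_inner_wave_volterra:
  assumes "L > 0" "z \<notin> \<real>" and f: "f \<in> l2_functions L"
    and approx: "\<And>e. e > 0 \<Longrightarrow> \<exists>p\<in>trig_polys L. fourier_hat L p z = 0 \<and> l2_norm L (\<lambda>x. f x - p x) < e"
  shows "l2_inner L (trig_basis L k) f = \<i> * (freq L k - z) * l2_inner L (trig_basis L k) (volterra z f)"
proof -
  let ?U = "trig_basis L k"
  define w where "w = \<i> * (freq L k - z)"
  obtain K where K: "K \<ge> 0" "\<And>f. f \<in> l2_functions L \<Longrightarrow> l2_norm L (volterra z f) \<le> K * l2_norm L f"
    using volterra_bounded[OF assms(1)] by blast
  define u where "u = l2_norm L ?U"
  have "u \<ge> 0" by (simp add: u_def l2_norm_nonneg)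
  define \<omega> where "\<omega> e = u * e + norm w * (u * (K * e))" for e
  have "norm (l2_inner L ?U f - w * l2_inner L ?U (volterra z f)) \<le> 0"
  proof (rule nonpos_if_le_tendsto_0)
    show "(\<omega> \<longlongrightarrow> 0) (at_right 0)"
      unfolding \<omega>_def[abs_def] by (auto intro!: tendsto_eq_intros)
    fix e :: real assume "e > 0"
    then obtain p where p: "p \<in> trig_polys L" "fourier_hat L p z = 0" "l2_norm L (\<lambda>x. f x - p x) < e"
      using approx by blast
    obtain H H' where dH: "\<And>x S. (H has_vector_derivative H' x) (at x within S)"
      and cH': "\<And>S. continuous_on S H'" and H0: "H 0 = 0" "H L = 0"
      and pH: "p = zero_ext L (\<lambda>x. H' x - \<i> * z * H x)" and tH: "zero_ext L H \<in> trig_polys L"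
      using trig_poly_primitive[OF assms(1,2) p(1,2)] by blast
    have pL: "p \<in> l2_functions L" by (rule trig_polys_l2[OF p(1)])
    have VH: "volterra z p x = H x" if "x \<in> {0..L}" for x
      unfolding pH by (rule volterra_primitive[OF dH H0(1) that])
    have "l2_inner L ?U p = w * l2_inner L ?U (zero_ext L H)"
      unfolding pH w_def by (rule l2_inner_wave_primitive[OF assms(1) dH cH' H0])
    also have "l2_inner L ?U (zero_ext L H) = l2_inner L ?U (volterra z p)"
      unfolding l2_inner_def by (rule integral_lebesgue_on_cong) (simp only: zero_ext_in VH)
    finally have "l2_inner L ?U f - w * l2_inner L ?U (volterra z f)
       = l2_inner L ?U (\<lambda>x. f x - p x) - w * l2_inner L ?U (\<lambda>x. volterra z f x - volterra z p x)"
      using f pL by (simp add: l2_inner_diff_right trig_basis_l2 volterra_l2 algebra_simps)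
    also have "l2_inner L ?U (\<lambda>x. volterra z f x - volterra z p x) = l2_inner L ?U (volterra z (\<lambda>x. f x - p x))"
      unfolding l2_inner_def by (rule integral_lebesgue_on_cong) (simp only: volterra_diff[OF f pL])
    finally have "norm (l2_inner L ?U f - w * l2_inner L ?U (volterra z f))
      \<le> norm (l2_inner L ?U (\<lambda>x. f x - p x)) + norm w * norm (l2_inner L ?U (volterra z (\<lambda>x. f x - p x)))"
      by (metis norm_triangle_ineq4 norm_mult)
    also have "\<dots> \<le> u * l2_norm L (\<lambda>x. f x - p x) + norm w * (u * l2_norm L (volterra z (\<lambda>x. f x - p x)))"
      unfolding u_def
      by (intro add_mono mult_left_mono l2_cauchy_schwarz l2_diff volterra_l2 f pL trig_basis_l2) simp
    also have "\<dots> \<le> \<omega> e"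
    proof -
      have "l2_norm L (volterra z (\<lambda>x. f x - p x)) \<le> K * l2_norm L (\<lambda>x. f x - p x)"
        by (intro K(2) l2_diff f pL)
      also have "\<dots> \<le> K * e" using p(3) K(1) by (intro mult_left_mono) auto
      finally show ?thesis
        unfolding \<omega>_def using p(3) \<open>u \<ge> 0\<close> by (intro add_mono mult_left_mono) auto
    qed
    finally show "norm (l2_inner L ?U f - w * l2_inner L ?U (volterra z f)) \<le> \<omega> e" .
  qed
  then show ?thesis by (simp add: w_def)
qed

text \<open>Completeness of the trigonometric system is read off from the dense domain of
  \<open>T\<close>, which consists of trigonometric polynomials up to null sets.\<close>

lemma orthogonal_trig_basis_imp_0:
  assumes T: "operator_of_form L D T" "densely_defined L T"
    and f: "f \<in> l2_functions L" and orth: "\<And>k. l2_inner L (trig_basis L k) f = 0"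
  shows "l2_norm L f = 0"
proof -
  have poly: "l2_inner L f p = 0" if pt: "p \<in> trig_polys L" for p
  proof -
    obtain S c where S: "finite S" and p: "p = (\<lambda>x. \<Sum>n\<in>S. c n * trig_basis L n x)"
      using pt by (auto simp: trig_polys_def)
    have "l2_inner L f (\<lambda>x. \<Sum>n\<in>S. c n * trig_basis L n x) = 0"
      using S
    proof (induction S rule: finite_induct)
      case empty
      then show ?case by (simp add: l2_inner_def)
    next
      case (insert n S)
      have "l2_inner L f (trig_basis L n) = 0"
        using orth[of n] l2_inner_commute[of L f "trig_basis L n"] by simp
      moreover have "l2_inner L f (\<lambda>x. \<Sum>n\<in>insert n S. c n * trig_basis L n x)
          = l2_inner L f (\<lambda>x. c n * trig_basis L n x) + l2_inner L f (\<lambda>x. \<Sum>n\<in>S. c n * trig_basis L n x)"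
        using insert by (simp add: l2_inner_add_right f l2_scale trig_basis_l2 l2_sum)
      ultimately show ?case using insert by (simp add: l2_inner_scale_right)
    qed
    then show ?thesis by (simp add: p)
  qed
  have le: "l2_norm L f \<le> e" if e: "e > 0" for e
  proof -
    obtain u where u: "u \<in> op_domain T" "l2_norm L (\<lambda>x. f x - u x) < e"
      using T(2) f e unfolding densely_defined_def by blast
    then obtain p where uL: "u \<in> l2_functions L" and p: "p \<in> trig_polys L" "l2_eq L u p"
      using T(1) unfolding operator_of_form_def by blast
    have "l2_inner L f u = 0"
      using l2_inner_cong_right[OF f uL trig_polys_l2[OF p(1)] p(2)] poly[OF p(1)] by simp
    then have "l2_inner L f (\<lambda>x. f x - u x) = of_real ((l2_norm L f)\<^sup>2)"
      using f uL by (simp add: l2_inner_diff_right l2_inner_self)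
    then have "(l2_norm L f)\<^sup>2 \<le> l2_norm L f * l2_norm L (\<lambda>x. f x - u x)"
      using l2_cauchy_schwarz[OF f l2_diff[OF f uL]] by (simp add: norm_power l2_norm_nonneg)
    also have "\<dots> \<le> l2_norm L f * e" using u(2) by (intro mult_left_mono l2_norm_nonneg) simp
    finally show ?thesis
      using e l2_norm_nonneg[of L f] by (cases "l2_norm L f = 0") (auto simp: power2_eq_square)
  qed
  have "l2_norm L f \<le> 0" by (rule field_le_epsilon) (use le in simp)
  then show ?thesis using l2_norm_nonneg[of L f] by simp
qed

text \<open>Replacing \<open>z\<close> by \<open>cnj z\<close> in approximants \<open>p\<close> of
  \<xi> keeps both form value and norm, so the new functions \<open>g\<close> almost minimise the
  form of \<open>A - lam\<close> and converge to \<eta>. Convergence of the images of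
  \<open>g\<close> is not known; Cauchy-Schwarz for that form instead shows \<eta> orthogonal to the
  range of \<open>A - lam\<close>, and selfadjointness concludes.\<close>

lemma eigenvector_conjugate_zero:
  assumes "L > 0" "z \<notin> \<real>" and T: "operator_of_form L D T"
    and A: "A = op_closure L T" "selfadjoint L A" and low: "lower_bound L A lam"
    and \<xi>: "\<xi> \<in> eigenspace A (of_real lam)" and \<xi>0: "fourier_hat L \<xi> z = 0"
  shows "(\<lambda>x. \<xi> x + \<i> * (z - cnj z) * volterra z \<xi> x) \<in> eigenspace A (of_real lam)"
proof -
  define \<kappa> where "\<kappa> = \<i> * (z - cnj z)"
  define \<eta> where "\<eta> x = \<xi> x + \<kappa> * volterra z \<xi> x" for x
  have opT: "l2_operator L T" using T by (simp add: operator_of_form_def)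
  have opA: "l2_operator L A" using A by (simp add: selfadjoint_def)
  have TA: "T \<subseteq> A" unfolding A(1) by (rule subset_op_closure[OF l2_operatorD(1)[OF opT]])
  have \<xi>A: "(\<xi>, \<lambda>x. of_real lam * \<xi> x) \<in> op_closure L T"
    using \<xi> A(1) by (simp add: eigenspace_def)
  then have \<xi>L: "\<xi> \<in> l2_functions L" by (auto simp: op_closure_def)
  obtain K where K: "K \<ge> 0" "\<And>f. f \<in> l2_functions L \<Longrightarrow> l2_norm L (volterra z f) \<le> K * l2_norm L f"
    using volterra_bounded[OF assms(1)] by blast
  have \<eta>L: "\<eta> \<in> l2_functions L"
    unfolding \<eta>_def[abs_def] by (intro l2_add l2_scale volterra_l2 \<xi>L)
  \<comment> \<open>The form of \<open>A - lam\<close> vanishes at \<xi>; \<omega> bounds the error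
    made on replacing \<xi> and its image by \<open>p\<close> and \<open>v\<close>.\<close>
  define \<omega> where "\<omega> e = e * (l2_norm L \<xi> + l2_norm L (\<lambda>x. of_real lam * \<xi> x) + e)
      + \<bar>lam\<bar> * (e * (l2_norm L \<xi> + l2_norm L \<xi> + e))" for e
  have approx: "\<exists>g w. (g, w) \<in> A \<and> l2_norm L (\<lambda>x. \<eta> x - g x) \<le> (1 + norm \<kappa> * K) * e \<and>
     Re (l2_inner L g w) - lam * (l2_norm L g)\<^sup>2 \<le> \<omega> e" if "e > 0" for e
  proof -
    obtain p v where pv: "(p, v) \<in> T" "p \<in> trig_polys L" "fourier_hat L p z = 0"
      "l2_norm L (\<lambda>x. \<xi> x - p x) < e" "l2_norm L (\<lambda>x. of_real lam * \<xi> x - v x) < e"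
      using op_closure_approx_zero[OF assms(1,2) T \<xi>A \<xi>0 \<open>e > 0\<close>] .
    obtain H H' where dH: "\<And>x S. (H has_vector_derivative H' x) (at x within S)"
      and cH': "\<And>S. continuous_on S H'" and H0: "H 0 = 0" "H L = 0"
      and pH: "p = zero_ext L (\<lambda>x. H' x - \<i> * z * H x)" and tH: "zero_ext L H \<in> trig_polys L"
      using trig_poly_primitive[OF assms(1,2) pv(2,3)] by blast
    have pL: "p \<in> l2_functions L" "v \<in> l2_functions L"
      using pv(1) l2_operatorD(1)[OF opT] by auto
    define g where "g = zero_ext L (\<lambda>x. H' x - \<i> * cnj z * H x)"
    have g: "g = (\<lambda>x. p x + \<kappa> * zero_ext L H x)"
      by (auto simp: g_def pH \<kappa>_def zero_ext_def algebra_simps)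
    then have gt: "g \<in> trig_polys L"
      by (simp add: trig_polys_add trig_polys_scale pv(2) tH)
    then obtain w where w: "(g, w) \<in> T" using operator_of_form_domain[OF T] by blast
    have gL: "g \<in> l2_functions L" by (rule trig_polys_l2[OF gt])
    \<comment> \<open>The diagonal of the form sees a function only through its
      autocorrelation.\<close>
    have "form_Q L D g g = form_Q L D p p"
      using autocorrelation_conjugate_zero[OF dH cH' H0, of z] by (simp add: form_Q_def g_def pH)
    moreover have "l2_inner L g w = form_Q L D g g" "l2_inner L p v = form_Q L D p p"
      using T w pv(1,2) gt unfolding operator_of_form_def by blast+
    ultimately have inn: "l2_inner L g w = l2_inner L p v" by simp
    have nrm: "l2_norm L g = l2_norm L p"
      using l2_norm_conjugate_zero[OF assms(1) dH cH' H0, of z] by (simp add: g_def pH)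
    have \<xi>L': "(\<lambda>x. of_real lam * \<xi> x) \<in> l2_functions L" by (rule l2_scale[OF \<xi>L])
    have 1: "norm (l2_inner L \<xi> (\<lambda>x. of_real lam * \<xi> x) - l2_inner L p v)
       \<le> e * (l2_norm L \<xi> + l2_norm L (\<lambda>x. of_real lam * \<xi> x) + e)"
      using pv \<open>e > 0\<close> by (intro l2_inner_dist_le \<xi>L \<xi>L' pL) auto
    have "norm (l2_inner L \<xi> \<xi> - l2_inner L p p) \<le> e * (l2_norm L \<xi> + l2_norm L \<xi> + e)"
      using pv \<open>e > 0\<close> by (intro l2_inner_dist_le \<xi>L pL) auto
    then have 2: "\<bar>lam\<bar> * norm (l2_inner L \<xi> \<xi> - l2_inner L p p) \<le> \<bar>lam\<bar> * (e * (l2_norm L \<xi> + l2_norm L \<xi> + e))"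
      by (rule mult_left_mono) simp
    have "Re (l2_inner L g w) - lam * (l2_norm L g)\<^sup>2
       = Re (of_real lam * (l2_inner L \<xi> \<xi> - l2_inner L p p)
          - (l2_inner L \<xi> (\<lambda>x. of_real lam * \<xi> x) - l2_inner L p v))"
      unfolding inn nrm l2_inner_scale_right by (simp add: l2_inner_self algebra_simps del: of_real_power)
    also have "\<dots> \<le> norm (of_real lam * (l2_inner L \<xi> \<xi> - l2_inner L p p)
          - (l2_inner L \<xi> (\<lambda>x. of_real lam * \<xi> x) - l2_inner L p v))"
      by (rule complex_Re_le_cmod)
    also have "\<dots> \<le> \<bar>lam\<bar> * norm (l2_inner L \<xi> \<xi> - l2_inner L p p)
          + norm (l2_inner L \<xi> (\<lambda>x. of_real lam * \<xi> x) - l2_inner L p v)"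
      by (rule order_trans[OF norm_triangle_ineq4]) (simp add: norm_mult)
    also have "\<dots> \<le> \<omega> e" unfolding \<omega>_def using 1 2 by linarith
    finally have q: "Re (l2_inner L g w) - lam * (l2_norm L g)\<^sup>2 \<le> \<omega> e" .
    have dL: "(\<lambda>x. \<xi> x - p x) \<in> l2_functions L" by (rule l2_diff[OF \<xi>L pL(1)])
    have VH: "volterra z p x = H x" if "x \<in> {0..L}" for x
      unfolding pH by (rule volterra_primitive[OF dH H0(1) that])
    have "l2_norm L (\<lambda>x. \<eta> x - g x)
       = l2_norm L (\<lambda>x. (\<xi> x - p x) + \<kappa> * volterra z (\<lambda>x. \<xi> x - p x) x)"
      unfolding l2_norm_def
      by (intro arg_cong[where f = sqrt] integral_lebesgue_on_cong)
        (simp add: \<eta>_def g volterra_diff[OF \<xi>L pL(1)] VH zero_ext_in algebra_simps)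
    also have "\<dots> \<le> l2_norm L (\<lambda>x. \<xi> x - p x) + norm \<kappa> * l2_norm L (volterra z (\<lambda>x. \<xi> x - p x))"
      using l2_norm_triangle[OF dL l2_scale[OF volterra_l2[OF dL], of \<kappa>]] by (simp add: l2_norm_scale)
    also have "\<dots> \<le> l2_norm L (\<lambda>x. \<xi> x - p x) + norm \<kappa> * (K * l2_norm L (\<lambda>x. \<xi> x - p x))"
      by (intro add_left_mono mult_left_mono K(2) dL) simp
    also have "\<dots> = (1 + norm \<kappa> * K) * l2_norm L (\<lambda>x. \<xi> x - p x)"
      by (simp add: algebra_simps)
    also have "\<dots> \<le> (1 + norm \<kappa> * K) * e"
      using pv(4) K(1) by (intro mult_left_mono) auto
    finally show ?thesis using w TA q by blast
  qed
  have "l2_inner L \<eta> u' = l2_inner L (\<lambda>x. of_real lam * \<eta> x) u" if u: "(u, u') \<in> A" for u u'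
  proof -
    have uL: "u \<in> l2_functions L" "u' \<in> l2_functions L" using u l2_operatorD(1)[OF opA] by auto
    let ?d = "\<lambda>x. u' x - of_real lam * u x"
    have dL: "?d \<in> l2_functions L" by (intro l2_diff l2_scale uL)
    have ip: "l2_inner L h ?d = l2_inner L h u' - of_real lam * l2_inner L h u" if "h \<in> l2_functions L" for h
      using that uL by (simp add: l2_inner_diff_right l2_inner_scale_right l2_scale)
    define q where "q = Re (l2_inner L u u') - lam * (l2_norm L u)\<^sup>2"
    have "q \<ge> 0" using low u unfolding q_def lower_bound_def by auto
    \<comment> \<open>The first term comes from the distance between \<eta> and \<open>g\<close>,
      the second from Cauchy-Schwarz for the form of \<open>A - lam\<close>.\<close>
    define \<Omega> where "\<Omega> e = (1 + norm \<kappa> * K) * e * l2_norm L ?d + sqrt (\<omega> e * q)" for e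
    have "norm (l2_inner L \<eta> ?d) \<le> 0"
    proof (rule nonpos_if_le_tendsto_0)
      show "(\<Omega> \<longlongrightarrow> 0) (at_right 0)"
        unfolding \<Omega>_def[abs_def] \<omega>_def by (auto intro!: tendsto_eq_intros)
      fix e :: real assume "e > 0"
      then obtain g w where g: "(g, w) \<in> A" "l2_norm L (\<lambda>x. \<eta> x - g x) \<le> (1 + norm \<kappa> * K) * e"
        "Re (l2_inner L g w) - lam * (l2_norm L g)\<^sup>2 \<le> \<omega> e"
        using approx by blast
      have gL: "g \<in> l2_functions L" using g(1) l2_operatorD(1)[OF opA] by auto
      have "(norm (l2_inner L g ?d))\<^sup>2 \<le> (Re (l2_inner L g w) - lam * (l2_norm L g)\<^sup>2) * q"
        unfolding ip[OF gL] q_def by (rule lower_bound_cauchy_schwarz[OF A(2) low g(1) u])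
      also have "\<dots> \<le> \<omega> e * q" using g(3) \<open>q \<ge> 0\<close> by (rule mult_right_mono)
      finally have 1: "norm (l2_inner L g ?d) \<le> sqrt (\<omega> e * q)" by (rule real_le_rsqrt)
      have "norm (l2_inner L (\<lambda>x. \<eta> x - g x) ?d) \<le> l2_norm L (\<lambda>x. \<eta> x - g x) * l2_norm L ?d"
        by (intro l2_cauchy_schwarz l2_diff \<eta>L gL dL)
      also have "\<dots> \<le> (1 + norm \<kappa> * K) * e * l2_norm L ?d"
        by (rule mult_right_mono[OF g(2) l2_norm_nonneg])
      finally have 2: "norm (l2_inner L (\<lambda>x. \<eta> x - g x) ?d) \<le> (1 + norm \<kappa> * K) * e * l2_norm L ?d" .
      have "l2_inner L \<eta> ?d = l2_inner L (\<lambda>x. \<eta> x - g x) ?d + l2_inner L g ?d"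
        using l2_inner_diff_left[OF dL \<eta>L gL] by simp
      then have "norm (l2_inner L \<eta> ?d) \<le> norm (l2_inner L (\<lambda>x. \<eta> x - g x) ?d) + norm (l2_inner L g ?d)"
        by (simp only: norm_triangle_ineq)
      then show "norm (l2_inner L \<eta> ?d) \<le> \<Omega> e" unfolding \<Omega>_def using 1 2 by linarith
    qed
    then show ?thesis using ip[OF \<eta>L] by (simp add: l2_inner_scale_left)
  qed
  \<comment> \<open>The eigenvalue equation tested against the whole domain is membership in the
    graph of the adjoint, which is \<open>A\<close>.\<close>
  then have "(\<eta>, \<lambda>x. of_real lam * \<eta> x) \<in> op_adjoint L A"
    using \<eta>L l2_scale[OF \<eta>L] unfolding op_adjoint_def by blast
  then have "\<eta> \<in> eigenspace A (of_real lam)"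
    using A(2) by (simp add: selfadjoint_def eigenspace_def)
  then show ?thesis by (simp add: \<eta>_def[abs_def] \<kappa>_def)
qed

text \<open>Each Fourier coefficient of \<open>f\<close> equals itself times
  \<open>i (freq L k - z) a\<close>. This factor is 1 for at most one \<open>k\<close>, so
  \<open>f\<close> is a multiple of a single basis function, whose transform has no nonreal
  zero.\<close>

lemma volterra_eigenvector_imp_0:
  assumes "L > 0" "z \<notin> \<real>" and T: "operator_of_form L D T" "densely_defined L T"
    and fA: "(f, g) \<in> op_closure L T" and f0: "fourier_hat L f z = 0"
    and eig: "l2_eq L (volterra z f) (\<lambda>x. a * f x)"
  shows "l2_eq L f (\<lambda>x. 0)"
proof -
  have f: "f \<in> l2_functions L" using fA by (auto simp: op_closure_def)
  have coef: "l2_inner L (trig_basis L k) f = 0 \<or> \<i> * (freq L k - z) * a = 1" for k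
  proof -
    have "l2_inner L (trig_basis L k) f = \<i> * (freq L k - z) * l2_inner L (trig_basis L k) (volterra z f)"
      by (rule l2_inner_wave_volterra[OF assms(1,2) f])
        (use op_closure_approx_zero[OF assms(1,2) T(1) fA f0] in blast)
    also have "l2_inner L (trig_basis L k) (volterra z f) = a * l2_inner L (trig_basis L k) f"
      using l2_inner_cong_right[OF trig_basis_l2 volterra_l2[OF f] l2_scale[OF f] eig]
      by (simp add: l2_inner_scale_right)
    also have "\<i> * (freq L k - z) * (a * l2_inner L (trig_basis L k) f)
        = \<i> * (freq L k - z) * a * l2_inner L (trig_basis L k) f"
      by (simp only: mult.assoc)
    finally have "l2_inner L (trig_basis L k) f = \<i> * (freq L k - z) * a * l2_inner L (trig_basis L k) f" .
    then show ?thesis unfolding mult_cancel_right1 .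
  qed
  have inj: "j = k" if "freq L j = freq L k" for j k
    using that assms(1) by (simp add: freq_def)
  have "\<exists>k0. \<forall>k. k \<noteq> k0 \<longrightarrow> l2_inner L (trig_basis L k) f = 0"
  proof (cases "\<exists>k0. \<i> * (freq L k0 - z) * a = 1")
    case True
    then obtain k0 where k0: "\<i> * (freq L k0 - z) * a = 1" by blast
    have "k = k0" if "\<i> * (freq L k - z) * a = 1" for k
    proof (rule inj)
      have "a \<noteq> 0" using k0 by auto
      moreover have "\<i> * (freq L k - z) * a = \<i> * (freq L k0 - z) * a" using that k0 by simp
      ultimately show "freq L k = freq L k0" by simp
    qed
    then show ?thesis using coef by blast
  \<comment> \<open>If the factor is never 1, all coefficients vanish and any \<open>k0\<close> will
    do.\<close>
  qed (use coef in blast)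
  then obtain k0 where k0: "\<And>k. k \<noteq> k0 \<Longrightarrow> l2_inner L (trig_basis L k) f = 0" by blast
  define c where "c = l2_inner L (trig_basis L k0) f"
  define r where "r x = f x - c * trig_basis L k0 x" for x
  have sL: "(\<lambda>x. c * trig_basis L k0 x) \<in> l2_functions L" by (intro l2_scale trig_basis_l2)
  have rL: "r \<in> l2_functions L" unfolding r_def[abs_def] by (intro l2_diff f sL)
  have "l2_inner L (trig_basis L k) r = 0" for k
    using k0[of k] unfolding r_def[abs_def] l2_inner_diff_right[OF trig_basis_l2 f sL]
      l2_inner_scale_right l2_inner_trig_basis[OF assms(1)] by (auto simp: c_def)
  then have "l2_norm L r = 0" by (rule orthogonal_trig_basis_imp_0[OF T rL])
  then have "l2_eq L r (\<lambda>x. 0)" by (simp add: l2_norm_eq_0_iff[OF rL])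
  then have fc: "l2_eq L f (\<lambda>x. c * trig_basis L k0 x)" by (simp add: l2_eq_def r_def)
  have "fourier_hat L f z = c * fourier_hat L (trig_basis L k0) z"
    using l2_inner_cong_right[OF l2_cnj_exp f sL fc, of "- \<i> * z"]
    unfolding fourier_hat_eq_l2_inner l2_inner_scale_right .
  then have "c = 0" using f0 fourier_hat_trig_basis_ne_0[OF assms(1,2)] by simp
  then show ?thesis using fc by simp
qed

theorem theorem1p2:
  fixes L lam :: real
    and D :: "(real \<Rightarrow> complex) \<Rightarrow> complex"
    and T A :: l2_graph
    and \<xi> :: "real \<Rightarrow> complex"
  assumes "L > 0"
    and "real_distribution L D"
    and "operator_of_form L D T"
    and "lower_bounded L T"
    and "essentially_selfadjoint L T"
    and "A = op_closure L T"
    and "complex_of_real lam \<in> op_spectrum L A"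
    and "\<And>\<mu>::real. complex_of_real \<mu> \<in> op_spectrum L A \<Longrightarrow> lam \<le> \<mu>"
    and "complex_of_real lam isolated_in op_spectrum L A"
    and "simple_eigenvalue L A (complex_of_real lam)"
    and "\<xi> \<in> eigenspace A (complex_of_real lam)"
    and "\<not> l2_eq L \<xi> (\<lambda>x. 0)"
    and "AE x in lebesgue_on {0..L}. \<xi> (L - x) = \<xi> x"
  shows "\<forall>z. fourier_hat L \<xi> z = 0 \<longrightarrow> z \<in> \<real>"
proof (intro allI impI, rule ccontr)
  fix z assume \<xi>0: "fourier_hat L \<xi> z = 0" and z: "z \<notin> \<real>"
  have T: "densely_defined L T" and A: "selfadjoint L A" and opT: "l2_operator L T"
    using assms(5,6) by (auto simp: essentially_selfadjoint_def)
  have \<xi>A: "(\<xi>, \<lambda>x. complex_of_real lam * \<xi> x) \<in> A"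
    using assms(11) by (simp add: eigenspace_def)
  have \<xi>L: "\<xi> \<in> l2_functions L" using \<xi>A assms(6) by (auto simp: op_closure_def)
  have \<xi>n: "l2_norm L \<xi> \<noteq> 0" using assms(12) l2_norm_eq_0_iff[OF \<xi>L] by simp
  \<comment> \<open>Semiboundedness passes from \<open>T\<close> to its closure with some constant
    \<open>c\<close>; the spectral hypothesis then sharpens the constant to
    \<open>lam\<close>.\<close>
  obtain c where "lower_bound L T c"
    using assms(4) unfolding lower_bounded_def lower_bound_def by fastforce
  then have "lower_bound L A c"
    unfolding assms(6) by (rule lower_bound_closure[OF l2_operatorD(1)[OF opT]])
  then have low: "lower_bound L A lam"
    by (rule lower_bound_of_spectrum[OF A _ \<xi>A \<xi>n assms(8)])
  define \<kappa> where "\<kappa> = \<i> * (z - cnj z)"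
  define \<eta> where "\<eta> = (\<lambda>x. \<xi> x + \<kappa> * volterra z \<xi> x)"
  have \<eta>: "\<eta> \<in> eigenspace A (complex_of_real lam)"
    unfolding \<eta>_def \<kappa>_def
    by (rule eigenvector_conjugate_zero[OF assms(1) z assms(3,6) A low assms(11) \<xi>0])
  obtain e where "\<forall>f\<in>eigenspace A (complex_of_real lam). \<exists>c. l2_eq L f (\<lambda>x. c * e x)"
    using assms(10) by (auto simp: simple_eigenvalue_def)
  then obtain s t where s: "l2_eq L \<xi> (\<lambda>x. s * e x)" and t: "l2_eq L \<eta> (\<lambda>x. t * e x)"
    using \<eta> assms(11) by blast
  have "s \<noteq> 0" using s assms(12) by auto
  \<comment> \<open>\<kappa> is \<open>- 2 * Im z\<close>.\<close>
  have "\<kappa> \<noteq> 0" using z by (auto simp: \<kappa>_def Reals_cnj_iff)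
  \<comment> \<open>In the one-dimensional eigenspace \<eta> is \<open>t / s\<close> times \<xi>;
    solving the definition of \<eta> for the Volterra term gives the factor.\<close>
  have "l2_eq L (volterra z \<xi>) (\<lambda>x. (t / s - 1) / \<kappa> * \<xi> x)"
    using s t unfolding l2_eq_def
  proof eventually_elim
    case (elim x)
    then have "t * e x = t / s * \<xi> x" using \<open>s \<noteq> 0\<close> by simp
    then have "\<xi> x + \<kappa> * volterra z \<xi> x = t / s * \<xi> x"
      using elim(2) unfolding \<eta>_def by (rule trans[rotated])
    then have "\<kappa> * volterra z \<xi> x = (t / s - 1) * \<xi> x"
      unfolding left_diff_distrib by (simp only: eq_diff_eq add.commute mult_1)
    then show ?case using \<open>\<kappa> \<noteq> 0\<close> by (simp add: eq_divide_eq mult.commute)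
  qed
  then have "l2_eq L \<xi> (\<lambda>x. 0)"
    using \<xi>A \<xi>0 unfolding assms(6) by (intro volterra_eigenvector_imp_0[OF assms(1) z assms(3) T])
  then show False using assms(12) by simp
qed

end
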